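(* Let $M$ be a smooth, second countable, paracompact manifold of dimension $n$ (boundary allowed) and let $p,q\ge 0$ be integers with $p+q=n$. Then $\mathcal{G}^{p,q}\subset S^2T^*M$ is an open subbundle. For $(p,q)=(n,0)$ and any $g_0,g_1\in \mathrm{Met}(M)$, the convex path $g_t:=(1-t)g_0+t g_1$ lies in $\mathrm{Met}(M)$ for all $t\in[0,1]$. Hence $\mathrm{Met}(M)$ is convex (in particular, contractible) in the Fréchet topology of $\Gamma(S^2T^*M)$.
   Context: $S^2T^*M\to M$ is the bundle of symmetric covariant $2$-tensors and $\Gamma(\cdot)$ denotes smooth sections. $\mathcal{G}^{p,q}\subset S^2T^*M$ is the subset whose fiber over $x\in M$ consists of the nondegenerate symmetric bilinear forms on $T_xM$ of inertia (signature) $(p,q)$. $\mathrm{Met}(M):=\Gamma(\mathcal{G}^{n,0})$ is the space of smooth Riemannian metrics on $M$. The Fréchet topology on $\Gamma(E)$, for a smooth finite-rank vector bundle $E\to M$, is induced by the seminorms $\|s\|_{C^k(K)}=\sum_{j=0}^k\sup_{x\in K}|\nabla^j s(x)|$, with $k\in\mathbb{N}$ and $K\subset M$ compact, where $\nabla$ is any auxiliary connection and $|\cdot|$ is induced by an auxiliary background Riemannian metric. *)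

theory Defs
  imports "HOL-Analysis.Analysis" "HOL-Library.Function_Algebras"
begin

text \<open>Pointwise vector space structure on functions. Tangent spaces, spaces of forms and spaces of
  sections below are linear subspaces of function types.\<close>

instantiation "fun" :: (type, real_vector) real_vector
begin

definition scaleR_fun :: "real \<Rightarrow> ('a \<Rightarrow> 'b) \<Rightarrow> 'a \<Rightarrow> 'b"
  where "scaleR_fun a f = (\<lambda>x. a *\<^sub>R f x)"

instance
  by standard (auto simp: scaleR_fun_def fun_eq_iff scaleR_add_right scaleR_add_left)

end


section \<open>Smooth maps\<close>

primrec Ck_on :: "nat \<Rightarrow> ('v::real_normed_vector \<Rightarrow> 'w::real_normed_vector) \<Rightarrow> 'v set \<Rightarrow> bool"
  where
    "Ck_on 0 = (\<lambda>f W. continuous_on W f)"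
  | "Ck_on (Suc k) = (\<lambda>f W. \<exists>f'. (\<forall>x\<in>W. (f has_derivative f' x) (at x)) \<and>
                                (\<forall>u. Ck_on k (\<lambda>x. f' x u) W))"

text \<open>On a set that is not open (charts at the boundary), smoothness means local
  extendability to a smooth map on an open set.\<close>

definition smooth_on :: "('v::real_normed_vector \<Rightarrow> 'w::real_normed_vector) \<Rightarrow> 'v set \<Rightarrow> bool"
  where "smooth_on f S \<longleftrightarrow>
    (\<forall>x\<in>S. \<exists>W F. open W \<and> x \<in> W \<and> (\<forall>k. Ck_on k F W) \<and> (\<forall>y\<in>W \<inter> S. F y = f y))"


section \<open>Smooth manifolds with boundary\<close>

type_synonym ('a, 'v) chart = "'a set \<times> ('a \<Rightarrow> 'v)"

record ('a, 'v) manifold =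
  mtop :: "'a topology"
  atlas :: "('a, 'v) chart set"

definition chart_inv :: "('a, 'v) chart \<Rightarrow> 'v \<Rightarrow> 'a"
  where "chart_inv c = inv_into (fst c) (snd c)"

definition chart_image :: "('a, 'v) chart \<Rightarrow> 'v set"
  where "chart_image c = snd c ` fst c"

text \<open>The image of a chart is relatively open in \<open>{y. 0 \<le> e \<bullet> y}\<close>: a closed half-space if
  \<open>e \<noteq> 0\<close>, the whole model space if \<open>e = 0\<close>.\<close>

definition is_chart :: "'a topology \<Rightarrow> ('a, 'v::real_inner) chart \<Rightarrow> bool"
  where "is_chart X c \<longleftrightarrow>
    openin X (fst c) \<and>
    (\<exists>e. openin (top_of_set {y. 0 \<le> e \<bullet> y}) (chart_image c)) \<and>
    homeomorphic_map (subtopology X (fst c)) (top_of_set (chart_image c)) (snd c)"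

text \<open>The model space is an arbitrary \<open>n\<close>-dimensional real inner product space \<open>'v\<close>; unlike
  \<open>real ^ 'n\<close> this includes \<open>n = 0\<close>.\<close>

definition smooth_manifold :: "nat \<Rightarrow> ('a, 'v::real_inner) manifold \<Rightarrow> bool"
  where "smooth_manifold n M \<longleftrightarrow>
    (\<exists>B :: 'v set. finite B \<and> independent B \<and> span B = UNIV \<and> card B = n) \<and>
    Hausdorff_space (mtop M) \<and>
    (\<Union>c\<in>atlas M. fst c) = topspace (mtop M) \<and>
    (\<forall>c\<in>atlas M. is_chart (mtop M) c) \<and>
    (\<forall>c\<in>atlas M. \<forall>d\<in>atlas M. smooth_on (snd d \<circ> chart_inv c) (snd c ` (fst c \<inter> fst d)))"

definition paracompact_space :: "'a topology \<Rightarrow> bool"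
  where "paracompact_space X \<longleftrightarrow>
    (\<forall>\<U>. (\<forall>U\<in>\<U>. openin X U) \<and> \<Union>\<U> = topspace X \<longrightarrow>
      (\<exists>\<V>. (\<forall>V\<in>\<V>. openin X V) \<and> \<Union>\<V> = topspace X \<and>
           (\<forall>V\<in>\<V>. \<exists>U\<in>\<U>. V \<subseteq> U) \<and> locally_finite_in X \<V>))"

definition smooth_functions :: "('a, 'v::real_inner) manifold \<Rightarrow> ('a \<Rightarrow> real) set"
  where "smooth_functions M = {f. \<forall>c\<in>atlas M. smooth_on (f \<circ> chart_inv c) (chart_image c)}"


section \<open>Tangent spaces\<close>

text \<open>A tangent vector at \<open>x\<close> assigns to every chart around \<open>x\<close> a coordinate vector, subject to
  the transformation law under changes of charts; it is \<open>0\<close> at all other charts.\<close>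

type_synonym ('a, 'v) tvec = "('a, 'v) chart \<Rightarrow> 'v"

definition trans_deriv :: "('a, 'v::real_inner) chart \<Rightarrow> ('a, 'v) chart \<Rightarrow> 'a \<Rightarrow> 'v \<Rightarrow> 'v"
  where "trans_deriv c d x =
    frechet_derivative (snd d \<circ> chart_inv c) (at (snd c x) within snd c ` (fst c \<inter> fst d))"

definition charts_at :: "('a, 'v) manifold \<Rightarrow> 'a \<Rightarrow> ('a, 'v) chart set"
  where "charts_at M x = {c \<in> atlas M. x \<in> fst c}"

definition tangent_space :: "('a, 'v::real_inner) manifold \<Rightarrow> 'a \<Rightarrow> ('a, 'v) tvec set"
  where "tangent_space M x =
    {\<xi>. (\<forall>c\<in>charts_at M x. \<forall>d\<in>charts_at M x. \<xi> d = trans_deriv c d x (\<xi> c)) \<and>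
        (\<forall>c. c \<notin> charts_at M x \<longrightarrow> \<xi> c = 0)}"

text \<open>The tangent vector at \<open>x\<close> with coordinates \<open>u\<close> in the chart \<open>c\<close>.\<close>

definition coord_vec :: "('a, 'v::real_inner) manifold \<Rightarrow> ('a, 'v) chart \<Rightarrow> 'a \<Rightarrow> 'v \<Rightarrow> ('a, 'v) tvec"
  where "coord_vec M c x u = (\<lambda>d. if d \<in> charts_at M x then trans_deriv c d x u else 0)"

definition differential ::
    "('a, 'v::real_inner) manifold \<Rightarrow> ('a \<Rightarrow> real) \<Rightarrow> 'a \<Rightarrow> ('a, 'v) tvec \<Rightarrow> real"
  where "differential M f x \<xi> =
    (let c = (SOME c. c \<in> charts_at M x)
     in frechet_derivative (f \<circ> chart_inv c) (at (snd c x) within chart_image c) (\<xi> c))"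


section \<open>Multilinear forms and inertia\<close>

text \<open>A \<open>k\<close>-linear form on a linear subspace \<open>V\<close> takes the list of its arguments; it is \<open>0\<close> on
  lists of the wrong length or with entries outside \<open>V\<close>.\<close>

definition multilinear_forms :: "nat \<Rightarrow> 'w::real_vector set \<Rightarrow> ('w list \<Rightarrow> real) set"
  where "multilinear_forms k V =
    {T. (\<forall>vs. \<not> (length vs = k \<and> set vs \<subseteq> V) \<longrightarrow> T vs = 0) \<and>
        (\<forall>us ws. length us + 1 + length ws = k \<and> set us \<subseteq> V \<and> set ws \<subseteq> V \<longrightarrow>
           (\<forall>v\<in>V. \<forall>w\<in>V. \<forall>a b.
              T (us @ (a *\<^sub>R v + b *\<^sub>R w) # ws) = a * T (us @ v # ws) + b * T (us @ w # ws)))}"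

text \<open>The space \<open>(V*)^j \<otimes> S^2 V*\<close>; the case \<open>j = 0\<close> is the space of symmetric bilinear forms.\<close>

definition sym2_tensors :: "nat \<Rightarrow> 'w::real_vector set \<Rightarrow> ('w list \<Rightarrow> real) set"
  where "sym2_tensors j V =
    {T \<in> multilinear_forms (j + 2) V. \<forall>us v w. T (us @ [v, w]) = T (us @ [w, v])}"

abbreviation sym_forms :: "'w::real_vector set \<Rightarrow> ('w list \<Rightarrow> real) set"
  where "sym_forms \<equiv> sym2_tensors 0"

definition sylvester_basis ::
    "'w::real_vector set \<Rightarrow> ('w list \<Rightarrow> real) \<Rightarrow> nat \<Rightarrow> nat \<Rightarrow> (nat \<Rightarrow> 'w) \<Rightarrow> bool"
  where "sylvester_basis V b p q e \<longleftrightarrow>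
    inj_on e {..<p + q} \<and> independent (e ` {..<p + q}) \<and> span (e ` {..<p + q}) = V \<and>
    (\<forall>i<p + q. \<forall>j<p + q. b [e i, e j] = (if i \<noteq> j then 0 else if i < p then 1 else - 1))"

text \<open>Nondegenerate symmetric bilinear forms of inertia \<open>(p, q)\<close>. Nondegeneracy is implied, since
  a Sylvester basis spans \<open>V\<close> and no diagonal entry vanishes.\<close>

definition inertia_forms :: "nat \<Rightarrow> nat \<Rightarrow> 'w::real_vector set \<Rightarrow> ('w list \<Rightarrow> real) set"
  where "inertia_forms p q V = {b \<in> sym_forms V. \<exists>e. sylvester_basis V b p q e}"


section \<open>The bundle of symmetric covariant 2-tensors\<close>

definition S2T :: "('a, 'v::real_inner) manifold \<Rightarrow> ('a \<times> (('a, 'v) tvec list \<Rightarrow> real)) set"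
  where "S2T M = {(x, b). x \<in> topspace (mtop M) \<and> b \<in> sym_forms (tangent_space M x)}"

definition S2T_over ::
    "('a, 'v::real_inner) manifold \<Rightarrow> 'a set \<Rightarrow> ('a \<times> (('a, 'v) tvec list \<Rightarrow> real)) set"
  where "S2T_over M U = {z \<in> S2T M. fst z \<in> U}"

text \<open>The local trivialization of the bundle over the domain of a chart \<open>c\<close>, with fibre the
  symmetric bilinear forms on the model space.\<close>

definition S2T_triv ::
    "('a, 'v::real_inner) manifold \<Rightarrow> ('a, 'v) chart \<Rightarrow>
     'a \<times> (('a, 'v) tvec list \<Rightarrow> real) \<Rightarrow> 'a \<times> ('v list \<Rightarrow> real)"
  where "S2T_triv M c = (\<lambda>(x, b). (x, \<lambda>us. b (map (coord_vec M c x) us)))"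

text \<open>The topology of the finite-dimensional fibre. The library topology on functions is that of
  pointwise convergence, which restricts to the usual topology on a finite-dimensional subspace.\<close>

definition fibre_topology :: "('v::real_inner list \<Rightarrow> real) topology"
  where "fibre_topology = top_of_set (sym_forms UNIV)"

definition S2T_topology ::
    "('a, 'v::real_inner) manifold \<Rightarrow> ('a \<times> (('a, 'v) tvec list \<Rightarrow> real)) topology"
  where "S2T_topology M = topology (\<lambda>W. W \<subseteq> S2T M \<and>
    (\<forall>c\<in>atlas M. openin (prod_topology (subtopology (mtop M) (fst c)) fibre_topology)
                    (S2T_triv M c ` (W \<inter> S2T_over M (fst c)))))"

text \<open>The bundle trivializations in the second condition come from charts of the smooth atlas, so
  they are smooth.\<close>

definition open_subbundle ::
    "('a, 'v::real_inner) manifold \<Rightarrow> ('a \<times> (('a, 'v) tvec list \<Rightarrow> real)) set \<Rightarrow> bool"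
  where "open_subbundle M G \<longleftrightarrow>
    openin (S2T_topology M) G \<and>
    (\<exists>F. openin fibre_topology F \<and>
      (\<forall>x\<in>topspace (mtop M). \<exists>c\<in>charts_at M x.
         homeomorphic_map (subtopology (S2T_topology M) (S2T_over M (fst c)))
           (prod_topology (subtopology (mtop M) (fst c)) fibre_topology) (S2T_triv M c) \<and>
         S2T_triv M c ` (G \<inter> S2T_over M (fst c)) = fst c \<times> F))"

definition inertia_bundle ::
    "('a, 'v::real_inner) manifold \<Rightarrow> nat \<Rightarrow> nat \<Rightarrow> ('a \<times> (('a, 'v) tvec list \<Rightarrow> real)) set"
  where "inertia_bundle M p q =
    {(x, b). x \<in> topspace (mtop M) \<and> b \<in> inertia_forms p q (tangent_space M x)}"


section \<open>Smooth sections of covariant tensor bundles\<close>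

type_synonym ('a, 'v) tensor_field = "'a \<Rightarrow> ('a, 'v) tvec list \<Rightarrow> real"

text \<open>The bundle is given by its fibre as a function of the tangent space. Sections are extended by
  \<open>0\<close> outside the manifold, and smoothness is smoothness of all components in all charts.\<close>

definition smooth_sections ::
    "('a, 'v::real_inner) manifold \<Rightarrow> (('a, 'v) tvec set \<Rightarrow> (('a, 'v) tvec list \<Rightarrow> real) set) \<Rightarrow>
     ('a, 'v) tensor_field set"
  where "smooth_sections M F =
    {s. (\<forall>x\<in>topspace (mtop M). s x \<in> F (tangent_space M x)) \<and>
        (\<forall>x. x \<notin> topspace (mtop M) \<longrightarrow> s x = 0) \<and>
        (\<forall>c\<in>atlas M. \<forall>us. smooth_on
           (\<lambda>y. s (chart_inv c y) (map (coord_vec M c (chart_inv c y)) us)) (chart_image c))}"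

definition sym2_sections :: "('a, 'v::real_inner) manifold \<Rightarrow> ('a, 'v) tensor_field set"
  where "sym2_sections M = smooth_sections M sym_forms"

definition riemannian_metrics :: "nat \<Rightarrow> ('a, 'v::real_inner) manifold \<Rightarrow> ('a, 'v) tensor_field set"
  where "riemannian_metrics n M = smooth_sections M (inertia_forms n 0)"


section \<open>Connections\<close>

text \<open>A connection on the bundle with fibre \<open>F\<close>; the fibre of \<open>T*M \<otimes> F\<close> is \<open>F'\<close>, and the slot of the
  direction of differentiation is the first one.\<close>

definition is_connection ::
    "('a, 'v::real_inner) manifold \<Rightarrow> (('a, 'v) tvec set \<Rightarrow> (('a, 'v) tvec list \<Rightarrow> real) set) \<Rightarrow>
     (('a, 'v) tvec set \<Rightarrow> (('a, 'v) tvec list \<Rightarrow> real) set) \<Rightarrow>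
     (('a, 'v) tensor_field \<Rightarrow> ('a, 'v) tensor_field) \<Rightarrow> bool"
  where "is_connection M F F' D \<longleftrightarrow>
    (\<forall>s\<in>smooth_sections M F. D s \<in> smooth_sections M F') \<and>
    (\<forall>s\<in>smooth_sections M F. \<forall>t\<in>smooth_sections M F. D (s + t) = D s + D t) \<and>
    (\<forall>s\<in>smooth_sections M F. \<forall>a. D (a *\<^sub>R s) = a *\<^sub>R D s) \<and>
    (\<forall>f\<in>smooth_functions M. \<forall>s\<in>smooth_sections M F. \<forall>x\<in>topspace (mtop M).
       \<forall>\<xi>\<in>tangent_space M x. \<forall>vs.
         D (\<lambda>y. f y *\<^sub>R s y) x (\<xi> # vs) = differential M f x \<xi> * s x vs + f x * D s x (\<xi> # vs))"

text \<open>\<open>D j\<close> is the connection on \<open>(T*M)^j \<otimes> S^2 T*M\<close> induced by a connection \<open>nablaT\<close> on \<open>T*M\<close> and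
  a connection \<open>nablaE\<close> on \<open>S^2 T*M\<close>; the last clause is the product rule for
  \<open>D (\<alpha> \<otimes> s) = nablaT \<alpha> \<otimes> s + \<alpha> \<otimes> D s\<close>.\<close>

definition induced_connections ::
    "('a, 'v::real_inner) manifold \<Rightarrow> (('a, 'v) tensor_field \<Rightarrow> ('a, 'v) tensor_field) \<Rightarrow>
     (('a, 'v) tensor_field \<Rightarrow> ('a, 'v) tensor_field) \<Rightarrow>
     (nat \<Rightarrow> ('a, 'v) tensor_field \<Rightarrow> ('a, 'v) tensor_field) \<Rightarrow> bool"
  where "induced_connections M nablaT nablaE D \<longleftrightarrow>
    is_connection M (multilinear_forms 1) (multilinear_forms 2) nablaT \<and>
    is_connection M (sym2_tensors 0) (sym2_tensors 1) nablaE \<and>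
    (\<forall>j. is_connection M (sym2_tensors j) (sym2_tensors (Suc j)) (D j)) \<and>
    (\<forall>s\<in>sym2_sections M. D 0 s = nablaE s) \<and>
    (\<forall>j. \<forall>\<alpha>\<in>smooth_sections M (multilinear_forms 1). \<forall>s\<in>smooth_sections M (sym2_tensors j).
       \<forall>x\<in>topspace (mtop M). \<forall>\<xi>\<in>tangent_space M x. \<forall>\<eta>\<in>tangent_space M x. \<forall>vs.
         D (Suc j) (\<lambda>y vs. \<alpha> y (take 1 vs) * s y (drop 1 vs)) x (\<xi> # \<eta> # vs) =
           nablaT \<alpha> x [\<xi>, \<eta>] * s x vs + \<alpha> x [\<eta>] * D j s x (\<xi> # vs))"

primrec iter_deriv ::
    "(nat \<Rightarrow> ('a, 'v) tensor_field \<Rightarrow> ('a, 'v) tensor_field) \<Rightarrow> nat \<Rightarrow>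
     ('a, 'v) tensor_field \<Rightarrow> ('a, 'v) tensor_field"
  where
    "iter_deriv D 0 s = s"
  | "iter_deriv D (Suc j) s = D j (iter_deriv D j s)"


section \<open>The Frechet topology\<close>

text \<open>The norm of a \<open>k\<close>-linear form \<open>T\<close> on \<open>V\<close> induced by an inner product \<open>b\<close>: the Euclidean norm
  of the components of \<open>T\<close> in a \<open>b\<close>-orthonormal basis (the choice of which is immaterial).\<close>

definition tensor_norm ::
    "nat \<Rightarrow> 'w::real_vector set \<Rightarrow> ('w list \<Rightarrow> real) \<Rightarrow> nat \<Rightarrow> ('w list \<Rightarrow> real) \<Rightarrow> real"
  where "tensor_norm n V b k T =
    (let e = (SOME e. sylvester_basis V b n 0 e)
     in L2_set (\<lambda>is. T (map e is)) {is. length is = k \<and> set is \<subseteq> {..<n}})"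

text \<open>Inserting \<open>0\<close> only serves to make the supremum over the empty set equal to \<open>0\<close>.\<close>

definition Ck_seminorm ::
    "nat \<Rightarrow> ('a, 'v::real_inner) manifold \<Rightarrow> ('a, 'v) tensor_field \<Rightarrow>
     (nat \<Rightarrow> ('a, 'v) tensor_field \<Rightarrow> ('a, 'v) tensor_field) \<Rightarrow> nat \<Rightarrow> 'a set \<Rightarrow>
     ('a, 'v) tensor_field \<Rightarrow> real"
  where "Ck_seminorm n M h D k K s =
    (\<Sum>j\<le>k. Sup (insert 0
       ((\<lambda>x. tensor_norm n (tangent_space M x) (h x) (j + 2) (iter_deriv D j s x)) ` K)))"

definition frechet_topology ::
    "nat \<Rightarrow> ('a, 'v::real_inner) manifold \<Rightarrow> ('a, 'v) tensor_field \<Rightarrow>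
     (nat \<Rightarrow> ('a, 'v) tensor_field \<Rightarrow> ('a, 'v) tensor_field) \<Rightarrow> ('a, 'v) tensor_field topology"
  where "frechet_topology n M h D = topology_generated_by
    {{s \<in> sym2_sections M. Ck_seminorm n M h D k K (s - s0) < r} | s0 k K r.
       s0 \<in> sym2_sections M \<and> compactin (mtop M) K \<and> 0 < r}"

end

theory Submission
  imports Defs
begin

text \<open>
  Inertia is invariant under linear isomorphisms, so in the trivialization over a chart the bundle of
  forms of inertia \<open>(p, q)\<close> becomes the product of the chart domain with the set of forms of
  inertia \<open>(p, q)\<close> on the model space. Two facts make it an open subbundle. That set of forms is
  open (\<open>openin_inertia_forms\<close>): the Gram--Schmidt process applied to a Sylvester basis of
  \<open>b\<^sub>0\<close> is continuous in the form, hence it still succeeds, with the same signs, for every form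
  near \<open>b\<^sub>0\<close>. And the trivializations are homeomorphisms (\<open>triv_homeomorphic\<close>), because they
  differ by the derivatives of the transition maps, which depend continuously on the base point.
  At a boundary point these derivatives are taken within a half-space; they are nevertheless unique
  and satisfy the chain rule, because every line through a point of a half-space stays in it on one
  side at least.

  A symmetric form on an \<open>n\<close>-dimensional space has inertia \<open>(n, 0)\<close> exactly if it is positive
  definite (\<open>positive_definite_inertia\<close>, \<open>inertia_positive_definite\<close>), and positive definiteness
  passes to convex combinations. Since linear combinations of smooth sections are smooth, the metrics
  form a convex set.

  A convex set is contractible along straight lines provided that addition and scaling are continuous,
  which holds for a topology given by seminorms. What has to be shown is that the expressions
  defining the Frechet topology are seminorms, that is, that the suprema over compact sets are finite.
  The difficulty is that the norm of a tensor is computed in an arbitrarily chosen orthonormal basis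
  that need not vary continuously with the base point. But a frame which is orthonormal at \<open>x\<^sub>0\<close>
  and constant in the coordinates of a chart is almost orthonormal near \<open>x\<^sub>0\<close>, so every
  orthonormal basis has uniformly bounded coefficients in it; the norm is therefore bounded by
  the components of the tensor in this frame, which are continuous (\<open>tensor_norm_locally_bounded\<close>).
\<close>


section \<open>Symmetric bilinear forms on lists of arguments\<close>

lemma multilinear_forms_zero:
  assumes "T \<in> multilinear_forms k V" "length vs \<noteq> k \<or> \<not> set vs \<subseteq> V"
  shows "T vs = 0"
  using assms unfolding multilinear_forms_def by blast

lemma multilinear_forms_slot:
  assumes "T \<in> multilinear_forms k V" "length us + 1 + length ws = k" "set us \<subseteq> V" "set ws \<subseteq> V"
    "v \<in> V" "w \<in> V"
  shows "T (us @ (a *\<^sub>R v + b *\<^sub>R w) # ws) = a * T (us @ v # ws) + b * T (us @ w # ws)"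
  using assms unfolding multilinear_forms_def by blast

lemma multilinear_forms_slot_sum:
  assumes T: "T \<in> multilinear_forms k V" and V: "subspace V"
    and l: "length us + 1 + length ws = k" "set us \<subseteq> V" "set ws \<subseteq> V"
    and v: "\<And>i. i \<in> I \<Longrightarrow> v i \<in> V"
  shows "T (us @ (\<Sum>i\<in>I. a i *\<^sub>R v i) # ws) = (\<Sum>i\<in>I. a i * T (us @ v i # ws))"
  using v
proof (induction I rule: infinite_finite_induct)
  case (insert i I)
  have "(\<Sum>i\<in>I. a i *\<^sub>R v i) \<in> V"
    using insert.prems by (intro subspace_sum[OF V] subspace_mul[OF V]) auto
  then have "T (us @ (a i *\<^sub>R v i + 1 *\<^sub>R (\<Sum>i\<in>I. a i *\<^sub>R v i)) # ws) =
      a i * T (us @ v i # ws) + 1 * T (us @ (\<Sum>i\<in>I. a i *\<^sub>R v i) # ws)"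
    using insert.prems by (intro multilinear_forms_slot[OF T l]) auto
  then show ?case using insert by simp
next
  case empty
  have "T (us @ (0 *\<^sub>R 0 + 0 *\<^sub>R 0) # ws) = 0 * T (us @ 0 # ws) + 0 * T (us @ 0 # ws)"
    using subspace_0[OF V] by (intro multilinear_forms_slot[OF T l]) auto
  then show ?case by simp
next
  case (infinite I)
  have "T (us @ (0 *\<^sub>R 0 + 0 *\<^sub>R 0) # ws) = 0 * T (us @ 0 # ws) + 0 * T (us @ 0 # ws)"
    using subspace_0[OF V] by (intro multilinear_forms_slot[OF T l]) auto
  with infinite show ?case by simp
qed

lemma sym_forms_multilinear:
  assumes "b \<in> sym_forms V"
  shows "b \<in> multilinear_forms 2 V"
  using assms by (simp add: sym2_tensors_def numeral_2_eq_2)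

lemma sym_forms_zero:
  assumes "b \<in> sym_forms V" "length vs \<noteq> 2 \<or> \<not> set vs \<subseteq> V"
  shows "b vs = 0"
  using multilinear_forms_zero[OF sym_forms_multilinear[OF assms(1)] assms(2)] .

lemma sym_forms_commute:
  assumes "b \<in> sym_forms V"
  shows "b [v, w] = b [w, v]"
proof -
  have "b ([] @ [v, w]) = b ([] @ [w, v])"
    using assms unfolding sym2_tensors_def by blast
  then show ?thesis by simp
qed

lemma sym_forms_sum_left:
  assumes "b \<in> sym_forms V" "subspace V" "w \<in> V" "\<And>i. i \<in> I \<Longrightarrow> v i \<in> V"
  shows "b [(\<Sum>i\<in>I. a i *\<^sub>R v i), w] = (\<Sum>i\<in>I. a i * b [v i, w])"
  using multilinear_forms_slot_sum[OF sym_forms_multilinear[OF assms(1)] assms(2), of "[]" "[w]" I v a]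
    assms(3,4) by simp

lemma sym_forms_sum_right:
  assumes "b \<in> sym_forms V" "subspace V" "w \<in> V" "\<And>i. i \<in> I \<Longrightarrow> v i \<in> V"
  shows "b [w, (\<Sum>i\<in>I. a i *\<^sub>R v i)] = (\<Sum>i\<in>I. a i * b [w, v i])"
  unfolding sym_forms_commute[OF assms(1), of w] by (rule sym_forms_sum_left[OF assms])

lemma sym_forms_linear_left:
  assumes "b \<in> sym_forms V" "u \<in> V" "v \<in> V" "w \<in> V"
  shows "b [x *\<^sub>R u + y *\<^sub>R v, w] = x * b [u, w] + y * b [v, w]"
  using multilinear_forms_slot[OF sym_forms_multilinear[OF assms(1)], of "[]" "[w]" u v x y]
    assms(2-4) by simp

lemma sym_forms_scaleR_left:
  assumes "b \<in> sym_forms V" "u \<in> V" "w \<in> V"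
  shows "b [x *\<^sub>R u, w] = x * b [u, w]"
  using sym_forms_linear_left[OF assms(1,2,2,3), of x 0] by simp

lemma sym_forms_scaleR_right:
  assumes "b \<in> sym_forms V" "u \<in> V" "w \<in> V"
  shows "b [w, x *\<^sub>R u] = x * b [w, u]"
  unfolding sym_forms_commute[OF assms(1), of w] by (rule sym_forms_scaleR_left[OF assms])

lemma sym_forms_diff_left:
  assumes "b \<in> sym_forms V" "u \<in> V" "v \<in> V" "w \<in> V"
  shows "b [u - v, w] = b [u, w] - b [v, w]"
  using sym_forms_linear_left[OF assms, of 1 "-1"] by simp

lemma sym_formsI:
  assumes z: "\<And>vs. \<not> (length vs = 2 \<and> set vs \<subseteq> V) \<Longrightarrow> b vs = 0"
    and s: "\<And>v w. v \<in> V \<Longrightarrow> w \<in> V \<Longrightarrow> b [v, w] = b [w, v]"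
    and l: "\<And>u v w x y. u \<in> V \<Longrightarrow> v \<in> V \<Longrightarrow> w \<in> V \<Longrightarrow>
      b [x *\<^sub>R u + y *\<^sub>R v, w] = x * b [u, w] + y * b [v, w]"
    and V: "subspace V"
  shows "b \<in> sym_forms V"
proof -
  have comb: "x *\<^sub>R u + y *\<^sub>R v \<in> V" if "u \<in> V" "v \<in> V" for u v x y
    using that V by (simp add: subspace_add subspace_mul)
  have slot: "b (us @ (x *\<^sub>R v + y *\<^sub>R w) # ws) = x * b (us @ v # ws) + y * b (us @ w # ws)"
    if "length us + 1 + length ws = 2" "set us \<subseteq> V" "set ws \<subseteq> V" "v \<in> V" "w \<in> V" for us ws v w x y
  proof (cases us)
    case Nil
    then have "length ws = Suc 0" using that(1) by simp
    then obtain c where "ws = [c]" by (auto simp: length_Suc_conv)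
    then show ?thesis using Nil that l by simp
  next
    case (Cons c us')
    then have "us' = []" "ws = []" using that(1) by auto
    then show ?thesis
      using Cons that l[of v w c x y] s comb[of v w x y] by simp
  qed
  have "b (us @ [v, w]) = b (us @ [w, v])" for us v w
  proof (cases "us = [] \<and> v \<in> V \<and> w \<in> V")
    case True
    then show ?thesis using s by simp
  next
    case False
    then have "\<not> (length (us @ [v, w]) = 2 \<and> set (us @ [v, w]) \<subseteq> V)"
      "\<not> (length (us @ [w, v]) = 2 \<and> set (us @ [w, v]) \<subseteq> V)" by auto
    then show ?thesis using z by metis
  qed
  then show ?thesis
    using z slot unfolding sym2_tensors_def multilinear_forms_def by simp
qed

text \<open>Both directions of the local trivialization of the bundle are of this kind. The explicit
  case distinction keeps the convention that a form vanishes outside its subspace, even where \<open>L\<close>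
  maps an argument outside \<open>V'\<close> into \<open>V\<close>.\<close>

lemma pullback_sym_form:
  assumes b: "b \<in> sym_forms V" and V: "subspace V" "subspace V'"
    and L: "linear L" "\<And>v. v \<in> V' \<Longrightarrow> L v \<in> V"
  shows "(\<lambda>vs. if set vs \<subseteq> V' then b (map L vs) else 0) \<in> sym_forms V'"
proof (rule sym_formsI[OF _ _ _ V(2)])
  fix vs :: "'b list"
  assume "\<not> (length vs = 2 \<and> set vs \<subseteq> V')"
  then show "(if set vs \<subseteq> V' then b (map L vs) else 0) = 0"
    using sym_forms_zero[OF b, of "map L vs"] by auto
next
  fix u v w :: 'b and x y :: real
  assume *: "u \<in> V'" "v \<in> V'" "w \<in> V'"
  then have "x *\<^sub>R u + y *\<^sub>R v \<in> V'" using V(2) by (simp add: subspace_add subspace_mul)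
  then show "(if set [x *\<^sub>R u + y *\<^sub>R v, w] \<subseteq> V' then b (map L [x *\<^sub>R u + y *\<^sub>R v, w]) else 0) =
      x * (if set [u, w] \<subseteq> V' then b (map L [u, w]) else 0) +
      y * (if set [v, w] \<subseteq> V' then b (map L [v, w]) else 0)"
    using * L by (simp add: linear_add linear_scale sym_forms_linear_left[OF b])
qed (use sym_forms_commute[OF b] in auto)


section \<open>Pseudo-orthonormal systems and the Gram--Schmidt process\<close>

definition pseudo_orthonormal ::
    "'w::real_vector set \<Rightarrow> ('w list \<Rightarrow> real) \<Rightarrow> (nat \<Rightarrow> real) \<Rightarrow> nat \<Rightarrow> (nat \<Rightarrow> 'w) \<Rightarrow> bool"
  where "pseudo_orthonormal V b \<sigma> m e \<longleftrightarrow>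
    (\<forall>i<m. e i \<in> V) \<and> (\<forall>i<m. \<forall>j<m. b [e i, e j] = (if i = j then \<sigma> i else 0))"

definition inertia_sign :: "nat \<Rightarrow> nat \<Rightarrow> real"
  where "inertia_sign p i = (if i < p then 1 else -1)"

lemma inertia_sign_square [simp]: "inertia_sign p i * inertia_sign p i = 1"
  by (simp add: inertia_sign_def)

lemma inertia_sign_nonzero [simp]: "inertia_sign p i \<noteq> 0"
  by (simp add: inertia_sign_def)

lemma sylvester_basis_pseudo_orthonormal:
  assumes "sylvester_basis V b p q e"
  shows "pseudo_orthonormal V b (inertia_sign p) (p + q) e"
  using assms span_base[of _ "e ` {..<p + q}"]
  unfolding sylvester_basis_def pseudo_orthonormal_def inertia_sign_def by auto

lemma pseudo_orthonormal_coeff: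
  assumes b: "b \<in> sym_forms V" "subspace V" and e: "pseudo_orthonormal V b \<sigma> m e" and j: "j < m"
  shows "b [(\<Sum>i<m. a i *\<^sub>R e i), e j] = a j * \<sigma> j"
proof -
  have "b [(\<Sum>i<m. a i *\<^sub>R e i), e j] = (\<Sum>i<m. a i * b [e i, e j])"
    using e j by (intro sym_forms_sum_left[OF b]) (auto simp: pseudo_orthonormal_def)
  also have "\<dots> = (\<Sum>i<m. if i = j then a i * \<sigma> i else 0)"
    using e j by (intro sum.cong) (auto simp: pseudo_orthonormal_def)
  finally show ?thesis using j by simp
qed

text \<open>A vanishing combination of the vectors pairs to \<open>0\<close> with each of them, while the pairing
  is a nonzero multiple of the coefficient.\<close>

lemma pseudo_orthonormal_independent:
  assumes b: "b \<in> sym_forms V" "subspace V" and e: "pseudo_orthonormal V b \<sigma> m e"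
    and \<sigma>: "\<And>i. \<sigma> i \<noteq> 0"
  shows "inj_on e {..<m}" "independent (e ` {..<m})"
proof -
  show inj: "inj_on e {..<m}"
  proof (rule inj_onI)
    fix i j assume ij: "i \<in> {..<m}" "j \<in> {..<m}" "e i = e j"
    then have "b [e i, e j] = \<sigma> j" using e by (auto simp: pseudo_orthonormal_def)
    moreover have "b [e i, e j] = (if i = j then \<sigma> i else 0)"
      using e ij(1,2) by (simp add: pseudo_orthonormal_def)
    ultimately show "i = j" using \<sigma>[of j] by presburger
  qed
  show "independent (e ` {..<m})"
  proof
    assume "dependent (e ` {..<m})"
    then obtain u where u: "\<exists>v\<in>e ` {..<m}. u v \<noteq> (0::real)" "(\<Sum>v\<in>e ` {..<m}. u v *\<^sub>R v) = 0"
      by (auto simp: dependent_finite)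
    then obtain j where j: "j < m" "u (e j) \<noteq> 0" by auto
    have "(\<Sum>i<m. u (e i) *\<^sub>R e i) = 0" using u(2) inj by (simp add: sum.reindex)
    moreover have "b [0, e j] = 0"
      using sym_forms_scaleR_left[OF b(1), of "e j" "e j" 0] e j by (auto simp: pseudo_orthonormal_def)
    ultimately show False
      using pseudo_orthonormal_coeff[OF b e j(1), of "\<lambda>i. u (e i)"] j \<sigma>[of j] by simp
  qed
qed

text \<open>The exchange lemma: a vector outside the span would enlarge \<open>S\<close> to an independent set with
  more elements than \<open>B\<close>. The ambient space may be infinite-dimensional, as the function space that
  contains the tangent spaces usually is.\<close>

lemma independent_card_spans:
  fixes S B :: "'w::real_vector set"
  assumes "finite B" "independent S" "finite S" "S \<subseteq> span B" "card B \<le> card S"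
  shows "span S = span B"
proof -
  have "a \<in> span S" if "a \<in> span B" for a
  proof (rule ccontr)
    assume a: "a \<notin> span S"
    then have "independent (insert a S)" "a \<notin> S"
      using assms(2) by (auto simp: independent_insert intro: span_base)
    then have "card (insert a S) \<le> card B"
      using independent_span_bound[OF assms(1), of "insert a S"] assms(4) that by auto
    then show False using \<open>a \<notin> S\<close> assms(3,5) by simp
  qed
  moreover have "span S \<subseteq> span B" using span_minimal[OF assms(4) subspace_span] .
  ultimately show ?thesis by auto
qed

text \<open>Spanning comes for free, by counting dimensions. Thus producing a Sylvester basis amounts to
  solving the orthogonality relations.\<close>

lemma pseudo_orthonormal_sylvester_basis:
  assumes b: "b \<in> sym_forms V" and B: "finite B" "span B = V" "card B \<le> p + q"
    and e: "pseudo_orthonormal V b (inertia_sign p) (p + q) e"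
  shows "sylvester_basis V b p q e"
proof -
  have V: "subspace V" using B(2) subspace_span by blast
  note ind = pseudo_orthonormal_independent[OF b V e inertia_sign_nonzero]
  have "span (e ` {..<p + q}) = span B"
    using e B by (intro independent_card_spans ind) (auto simp: pseudo_orthonormal_def card_image ind)
  then show ?thesis
    using ind e B(2) unfolding sylvester_basis_def pseudo_orthonormal_def inertia_sign_def by auto
qed

text \<open>For a pseudo-orthonormal \<open>f\<close>, the component of \<open>a\<close> orthogonal to the first \<open>k\<close> vectors; the sign \<open>\<sigma> i\<close> stands for the
  denominator \<open>b [f i, f i] = \<sigma> i\<close>, its own inverse.\<close>

definition gs_residue ::
    "('w::real_vector list \<Rightarrow> real) \<Rightarrow> (nat \<Rightarrow> real) \<Rightarrow> nat \<Rightarrow> (nat \<Rightarrow> 'w) \<Rightarrow> 'w \<Rightarrow> 'w"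
  where "gs_residue b \<sigma> k f a = a - (\<Sum>i<k. (\<sigma> i * b [a, f i]) *\<^sub>R f i)"

definition gs_vector ::
    "('w::real_vector list \<Rightarrow> real) \<Rightarrow> (nat \<Rightarrow> real) \<Rightarrow> nat \<Rightarrow> (nat \<Rightarrow> 'w) \<Rightarrow> 'w \<Rightarrow> 'w"
  where "gs_vector b \<sigma> k f a =
    (let g = gs_residue b \<sigma> k f a in (1 / sqrt (\<sigma> k * b [g, g])) *\<^sub>R g)"

text \<open>The only obstruction to a step of the process for an indefinite form is the sign of the square
  of the residue. In this form the step serves twice: for positive definite forms, where the sign is
  automatic, and for forms near a given one, where it persists by continuity.\<close>

lemma gram_schmidt_step:
  assumes b: "b \<in> sym_forms V" "subspace V" and f: "pseudo_orthonormal V b \<sigma> k f" and a: "a \<in> V"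
    and \<sigma>: "\<And>i. \<sigma> i * \<sigma> i = 1"
    and pos: "0 < \<sigma> k * b [gs_residue b \<sigma> k f a, gs_residue b \<sigma> k f a]"
  shows "pseudo_orthonormal V b \<sigma> (Suc k) (f(k := gs_vector b \<sigma> k f a))"
proof -
  define P where "P = (\<Sum>i<k. (\<sigma> i * b [a, f i]) *\<^sub>R f i)"
  define g where "g = gs_residue b \<sigma> k f a"
  define r where "r = sqrt (\<sigma> k * b [g, g])"
  have g: "g = a - P" unfolding g_def P_def gs_residue_def ..
  have fV: "f i \<in> V" if "i < k" for i using f that by (simp add: pseudo_orthonormal_def)
  have PV: "P \<in> V" unfolding P_def using fV by (intro subspace_sum[OF b(2)] subspace_mul[OF b(2)]) auto
  have gV: "g \<in> V" unfolding g using a PV b(2) by (simp add: subspace_diff)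
  have v: "gs_vector b \<sigma> k f a = (1 / r) *\<^sub>R g"
    unfolding gs_vector_def Let_def r_def g_def ..
  have orth: "b [g, f j] = 0" if "j < k" for j
  proof -
    have "b [g, f j] = b [a, f j] - \<sigma> j * b [a, f j] * \<sigma> j"
      unfolding g sym_forms_diff_left[OF b(1) a PV fV[OF that]]
      unfolding P_def pseudo_orthonormal_coeff[OF b f that] ..
    also have "\<dots> = b [a, f j] * (1 - \<sigma> j * \<sigma> j)" by (simp add: algebra_simps)
    finally show ?thesis using \<sigma> by simp
  qed
  have r: "r \<noteq> 0" "r * r = \<sigma> k * b [g, g]" using pos by (auto simp: r_def g_def)
  have "b [(1 / r) *\<^sub>R g, (1 / r) *\<^sub>R g] = b [g, g] / (r * r)"
    using gV subspace_mul[OF b(2) gV] by (simp add: sym_forms_scaleR_left[OF b(1)] sym_forms_scaleR_right[OF b(1)])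
  also have "\<dots> = \<sigma> k"
  proof -
    have "b [g, g] = \<sigma> k * (\<sigma> k * b [g, g])" by (simp add: mult.assoc[symmetric] \<sigma>)
    moreover have "\<sigma> k * b [g, g] \<noteq> 0" using pos unfolding g_def by linarith
    ultimately show ?thesis unfolding r(2) by (simp add: nonzero_divide_eq_eq)
  qed
  finally have norm: "b [(1 / r) *\<^sub>R g, (1 / r) *\<^sub>R g] = \<sigma> k" .
  have orth': "b [(1 / r) *\<^sub>R g, f j] = 0" "b [f j, (1 / r) *\<^sub>R g] = 0" if "j < k" for j
    using sym_forms_scaleR_left[OF b(1) gV fV[OF that], of "1 / r"] orth[OF that]
      sym_forms_commute[OF b(1), of "f j" "(1 / r) *\<^sub>R g"] by simp_all
  show ?thesis
    using f fV subspace_mul[OF b(2) gV] norm orth'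
    unfolding pseudo_orthonormal_def v by (auto simp: less_Suc_eq)
qed

definition positive_definite :: "'w::real_vector set \<Rightarrow> ('w list \<Rightarrow> real) \<Rightarrow> bool"
  where "positive_definite V b \<longleftrightarrow> (\<forall>v\<in>V. v \<noteq> 0 \<longrightarrow> 0 < b [v, v])"

text \<open>Gram--Schmidt: as long as there are fewer than \<open>n\<close> vectors, some element of the basis lies
  outside their span and its residue is nonzero, hence of positive square.\<close>

lemma positive_definite_inertia:
  assumes b: "b \<in> sym_forms V" and pd: "positive_definite V b"
    and B: "finite B" "independent B" "span B = V" "card B = n"
  shows "b \<in> inertia_forms n 0 V"
proof -
  have V: "subspace V" using B(3) subspace_span by blast
  have "\<exists>e. pseudo_orthonormal V b (inertia_sign n) k e" if "k \<le> n" for k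
    using that
  proof (induction k)
    case 0
    then show ?case by (simp add: pseudo_orthonormal_def)
  next
    case (Suc k)
    then obtain f where f: "pseudo_orthonormal V b (inertia_sign n) k f" by auto
    \<comment> \<open>fewer than \<open>n\<close> vectors cannot span\<close>
    have "\<exists>a\<in>B. a \<notin> span (f ` {..<k})"
    proof (rule ccontr)
      assume "\<not> ?thesis"
      then have "card B \<le> card (f ` {..<k})"
        by (intro conjunct2[OF independent_span_bound[OF _ B(2)]]) auto
      also have "\<dots> \<le> k" using card_image_le[of "{..<k}" f] by simp
      finally show False using Suc.prems B(4) by simp
    qed
    then obtain a where a: "a \<in> B" "a \<notin> span (f ` {..<k})" by blast
    have aV: "a \<in> V" using a(1) B(3) by (auto intro: span_base)
    define g where "g = gs_residue b (inertia_sign n) k f a"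
    have P: "(\<Sum>i<k. (inertia_sign n i * b [a, f i]) *\<^sub>R f i) \<in> span (f ` {..<k})"
      by (intro span_sum span_mul span_base) auto
    then have "g \<noteq> 0" using a(2) by (auto simp: g_def gs_residue_def)
    moreover have "g \<in> V"
      using f aV unfolding g_def gs_residue_def
      by (intro subspace_diff[OF V] subspace_sum[OF V] subspace_mul[OF V])
        (auto simp: pseudo_orthonormal_def)
    ultimately have "0 < inertia_sign n k * b [g, g]"
      using pd Suc.prems by (simp add: positive_definite_def inertia_sign_def)
    then show ?case
      using gram_schmidt_step[OF b V f aV] unfolding g_def by auto
  qed
  from this[of n] obtain e where "pseudo_orthonormal V b (inertia_sign n) (n + 0) e" by auto
  then show ?thesis
    using b B pseudo_orthonormal_sylvester_basis[of b V B n 0 e] by (auto simp: inertia_forms_def)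
qed

lemma span_image_lessThan:
  fixes e :: "nat \<Rightarrow> 'w::real_vector"
  assumes "v \<in> span (e ` {..<m})"
  obtains a where "v = (\<Sum>i<m. a i *\<^sub>R e i)"
proof -
  have "\<exists>a. v = (\<Sum>i<m. a i *\<^sub>R e i)"
    using assms
  proof (induction m arbitrary: v)
    case (Suc m)
    then obtain k where "v - k *\<^sub>R e m \<in> span (e ` {..<m})"
      using span_breakdown_eq[of v "e m" "e ` {..<m}"] by (auto simp: lessThan_Suc)
    then obtain a where "v - k *\<^sub>R e m = (\<Sum>i<m. a i *\<^sub>R e i)" using Suc.IH by blast
    then have "v = (\<Sum>i<Suc m. (a(m := k)) i *\<^sub>R e i)" by (simp add: algebra_simps)
    then show ?case by blast
  qed simp
  then show ?thesis using that by blast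
qed

lemma inertia_positive_definite:
  assumes b: "b \<in> inertia_forms n 0 V" and V: "subspace V"
  shows "positive_definite V b"
  unfolding positive_definite_def
proof (intro ballI impI)
  fix v assume v: "v \<in> V" "v \<noteq> 0"
  have bs: "b \<in> sym_forms V" using b by (simp add: inertia_forms_def)
  obtain e where e: "sylvester_basis V b n 0 e" using b by (auto simp: inertia_forms_def)
  note po = sylvester_basis_pseudo_orthonormal[OF e, simplified]
  obtain a where a: "v = (\<Sum>i<n. a i *\<^sub>R e i)"
    using e v(1) span_image_lessThan[of v e n] by (auto simp: sylvester_basis_def)
  have "b [v, (\<Sum>j<n. a j *\<^sub>R e j)] = (\<Sum>j<n. a j * b [v, e j])"
    using po v(1) by (intro sym_forms_sum_right[OF bs V]) (auto simp: pseudo_orthonormal_def)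
  also have "\<dots> = (\<Sum>j<n. a j * a j)"
    unfolding a using pseudo_orthonormal_coeff[OF bs V po]
    by (intro sum.cong) (auto simp: inertia_sign_def)
  finally have *: "b [v, v] = (\<Sum>j<n. a j * a j)" using a by simp
  obtain j where "j < n" "a j \<noteq> 0"
  proof (rule ccontr)
    assume "\<not> thesis"
    then have "a j = 0" if "j < n" for j using \<open>\<And>j. j < n \<Longrightarrow> a j \<noteq> 0 \<Longrightarrow> thesis\<close> that by blast
    then have "v = 0" using a by simp
    then show False using v by simp
  qed
  then have "0 < a j * a j" "a j * a j \<le> (\<Sum>j<n. a j * a j)"
    by (auto intro!: member_le_sum simp: zero_less_mult_iff)
  then show "0 < b [v, v]" using * by simp
qed

text \<open>Inertia is invariant under isometries: the image of a Sylvester basis satisfies the same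
  relations, and these force its independence.\<close>

lemma linear_image_sylvester_basis:
  assumes b: "b \<in> sym_forms V" and V: "subspace V" and L: "linear L" "L ` V' = V"
    and eq: "\<And>u v. u \<in> V' \<Longrightarrow> v \<in> V' \<Longrightarrow> b [L u, L v] = b' [u, v]"
    and e: "sylvester_basis V' b' p q e"
  shows "sylvester_basis V b p q (L \<circ> e)"
proof -
  note po = sylvester_basis_pseudo_orthonormal[OF e]
  have po': "pseudo_orthonormal V b (inertia_sign p) (p + q) (L \<circ> e)"
    using po eq L unfolding pseudo_orthonormal_def by auto
  have "span ((L \<circ> e) ` {..<p + q}) = V"
    using e L linear_span_image[OF L(1), of "e ` {..<p + q}"]
    by (simp add: sylvester_basis_def image_comp)
  then show ?thesis
    using pseudo_orthonormal_independent[OF b V po' inertia_sign_nonzero] po'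
    unfolding sylvester_basis_def pseudo_orthonormal_def inertia_sign_def by auto
qed

section \<open>Openness of the inertia condition\<close>

definition frame_expansion :: "nat \<Rightarrow> (nat \<Rightarrow> 'v::real_inner) \<Rightarrow> bool"
  where "frame_expansion n E \<longleftrightarrow> (\<forall>v. (\<Sum>i<n. (v \<bullet> E i) *\<^sub>R E i) = v)"

text \<open>The inner product is itself a positive definite symmetric form, so an orthonormal basis of the
  model space is a Sylvester basis for it.\<close>

lemma orthonormal_frame_exists:
  fixes B :: "'v::real_inner set"
  assumes B: "finite B" "independent B" "span B = UNIV" "card B = n"
  obtains E :: "nat \<Rightarrow> 'v" where "frame_expansion n E"
proof -
  define b :: "'v list \<Rightarrow> real" where "b vs = (if length vs = 2 then vs ! 0 \<bullet> vs ! 1 else 0)" for vs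
  have b2: "b [u, v] = u \<bullet> v" for u v by (simp add: b_def)
  have b: "b \<in> sym_forms UNIV"
  proof (rule sym_formsI)
    show "b vs = 0" if "\<not> (length vs = 2 \<and> set vs \<subseteq> UNIV)" for vs
      using that by (simp add: b_def)
  qed (simp_all add: b2 inner_add_left, simp add: inner_commute)
  have "positive_definite UNIV b" by (simp add: positive_definite_def b2)
  then have "b \<in> inertia_forms n 0 UNIV" by (rule positive_definite_inertia[OF b _ B])
  then obtain E where E: "sylvester_basis UNIV b n 0 E" by (auto simp: inertia_forms_def)
  note po = sylvester_basis_pseudo_orthonormal[OF E, simplified]
  have "(\<Sum>i<n. (v \<bullet> E i) *\<^sub>R E i) = v" for v
  proof -
    obtain a where a: "v = (\<Sum>i<n. a i *\<^sub>R E i)"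
      using E span_image_lessThan[of v E n] by (auto simp: sylvester_basis_def)
    have "v \<bullet> E j = a j" if "j < n" for j
      using pseudo_orthonormal_coeff[OF b subspace_UNIV po that, of a] that
      by (simp add: a b2 inertia_sign_def)
    then show ?thesis by (subst (2) a) simp
  qed
  then show ?thesis using that by (auto simp: frame_expansion_def)
qed

lemma sym_form_frame_expansion:
  assumes b: "b \<in> sym_forms UNIV" and E: "frame_expansion n E"
  shows "b [u, v] = (\<Sum>i<n. \<Sum>j<n. (u \<bullet> E i) * (v \<bullet> E j) * b [E i, E j])"
proof -
  have "b [u, v] = b [(\<Sum>i<n. (u \<bullet> E i) *\<^sub>R E i), (\<Sum>j<n. (v \<bullet> E j) *\<^sub>R E j)]"
    using E by (simp add: frame_expansion_def)
  also have "\<dots> = (\<Sum>i<n. (u \<bullet> E i) * (\<Sum>j<n. (v \<bullet> E j) * b [E i, E j]))"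
    unfolding sym_forms_sum_left[OF b subspace_UNIV UNIV_I UNIV_I]
    unfolding sym_forms_sum_right[OF b subspace_UNIV UNIV_I UNIV_I] ..
  finally show ?thesis by (simp add: sum_distrib_left mult.assoc)
qed

text \<open>Joint continuity of evaluation. In the topology of pointwise convergence the form converges only
  at fixed arguments; finite dimension reduces moving arguments to the finitely many fixed ones
  \<open>[E i, E j]\<close>.\<close>

lemma tendsto_sym_form:
  fixes u v :: "('v::real_inner list \<Rightarrow> real) \<Rightarrow> 'v" and E :: "nat \<Rightarrow> 'v"
  assumes b0: "b0 \<in> sym_forms UNIV" and E: "frame_expansion n E"
    and u: "(u \<longlongrightarrow> u0) (inf (nhds b0) (principal (sym_forms UNIV)))"
    and v: "(v \<longlongrightarrow> v0) (inf (nhds b0) (principal (sym_forms UNIV)))"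
  shows "((\<lambda>b. b [u b, v b]) \<longlongrightarrow> b0 [u0, v0]) (inf (nhds b0) (principal (sym_forms UNIV)))"
proof -
  let ?\<Phi> = "inf (nhds b0) (principal (sym_forms UNIV))"
  have ev: "((\<lambda>b. b us) \<longlongrightarrow> b0 us) ?\<Phi>" for us
  proof -
    have "((\<lambda>b. b us) \<longlongrightarrow> b0 us) (nhds b0)"
    proof (rule topological_tendstoI)
      fix S :: "real set"
      assume S: "open S" "b0 us \<in> S"
      have "open ((\<lambda>b :: 'v list \<Rightarrow> real. b us) -` S)"
        by (rule open_vimage[OF S(1)]) simp
      then show "\<forall>\<^sub>F b in nhds b0. b us \<in> S" using S by (auto simp: eventually_nhds)
    qed
    then show ?thesis by (rule tendsto_mono[rotated]) simp
  qed
  have "((\<lambda>b. \<Sum>i<n. \<Sum>j<n. (u b \<bullet> E i) * (v b \<bullet> E j) * b [E i, E j]) \<longlongrightarrow>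
      (\<Sum>i<n. \<Sum>j<n. (u0 \<bullet> E i) * (v0 \<bullet> E j) * b0 [E i, E j])) ?\<Phi>"
    by (intro tendsto_intros u v ev)
  moreover have "eventually (\<lambda>b. (\<Sum>i<n. \<Sum>j<n. (u b \<bullet> E i) * (v b \<bullet> E j) * b [E i, E j]) = b [u b, v b]) ?\<Phi>"
    unfolding eventually_inf_principal
    by (intro always_eventually) (auto simp: sym_form_frame_expansion[OF _ E])
  ultimately show ?thesis
    unfolding sym_form_frame_expansion[OF b0 E, of u0 v0] by (rule Lim_transform_eventually)
qed

text \<open>The process is started at a basis that is already orthonormal for \<open>b0\<close>, so in the limit it
  changes nothing: each new residue tends to \<open>e k\<close> and its signed square to \<open>1\<close>. In particular
  the square keeps its sign near \<open>b0\<close>, which makes the next step possible. The filter of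
  neighbourhoods within the symmetric forms absorbs the shrinking of the neighbourhood at each step.\<close>

lemma gram_schmidt_near:
  fixes b0 :: "'v::real_inner list \<Rightarrow> real" and E :: "nat \<Rightarrow> 'v"
  defines "\<Phi> \<equiv> inf (nhds b0) (principal (sym_forms UNIV))"
  assumes b0: "b0 \<in> sym_forms UNIV" and E: "frame_expansion n E"
    and e: "pseudo_orthonormal UNIV b0 \<sigma> m e" and \<sigma>: "\<And>i. \<sigma> i * \<sigma> i = 1"
  shows "k \<le> m \<Longrightarrow> \<exists>f. (\<forall>i<k. ((\<lambda>b. f b i) \<longlongrightarrow> e i) \<Phi>) \<and>
    (\<forall>\<^sub>F b in \<Phi>. pseudo_orthonormal UNIV b \<sigma> k (f b))"
proof (induction k)
  case 0
  then show ?case by (simp add: pseudo_orthonormal_def)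
next
  case (Suc k)
  then obtain f where f: "\<And>i. i < k \<Longrightarrow> ((\<lambda>b. f b i) \<longlongrightarrow> e i) \<Phi>"
    "\<forall>\<^sub>F b in \<Phi>. pseudo_orthonormal UNIV b \<sigma> k (f b)" by auto
  note form = tendsto_sym_form[OF b0 E, folded \<Phi>_def]
  define g where "g b = gs_residue b \<sigma> k (f b) (e k)" for b
  have "((\<lambda>b. g b) \<longlongrightarrow> e k - (\<Sum>i<k. (\<sigma> i * b0 [e k, e i]) *\<^sub>R e i)) \<Phi>"
    unfolding g_def gs_residue_def by (intro tendsto_intros form f) auto
  moreover have "b0 [e k, e i] = 0" if "i < k" for i
    using e Suc.prems that by (auto simp: pseudo_orthonormal_def)
  ultimately have g: "(g \<longlongrightarrow> e k) \<Phi>" by simp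
  have "b0 [e k, e k] = \<sigma> k" using e Suc.prems by (auto simp: pseudo_orthonormal_def)
  then have "((\<lambda>b. \<sigma> k * b [g b, g b]) \<longlongrightarrow> \<sigma> k * \<sigma> k) \<Phi>"
    using form[OF g g] by (intro tendsto_intros) simp
  then have n: "((\<lambda>b. \<sigma> k * b [g b, g b]) \<longlongrightarrow> 1) \<Phi>" using \<sigma> by simp
  have v: "((\<lambda>b. gs_vector b \<sigma> k (f b) (e k)) \<longlongrightarrow> e k) \<Phi>"
  proof -
    have "((\<lambda>b. (1 / sqrt (\<sigma> k * b [g b, g b])) *\<^sub>R g b) \<longlongrightarrow> (1 / sqrt 1) *\<^sub>R e k) \<Phi>"
      by (intro tendsto_intros n g) simp
    then show ?thesis by (simp add: gs_vector_def Let_def g_def)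
  qed
  have sym: "\<forall>\<^sub>F b in \<Phi>. b \<in> sym_forms UNIV"
    unfolding \<Phi>_def eventually_inf_principal by simp
  have "\<forall>\<^sub>F b in \<Phi>. 0 < \<sigma> k * b [g b, g b]"
    using order_tendstoD(1)[OF n, of 0] by simp
  then have po: "\<forall>\<^sub>F b in \<Phi>. pseudo_orthonormal UNIV b \<sigma> (Suc k) ((f b)(k := gs_vector b \<sigma> k (f b) (e k)))"
    using f(2) sym
  proof eventually_elim
    case (elim b)
    then show ?case
      using gram_schmidt_step[of b UNIV \<sigma> k "f b" "e k"] \<sigma> by (auto simp: g_def)
  qed
  have "((\<lambda>b. ((f b)(k := gs_vector b \<sigma> k (f b) (e k))) i) \<longlongrightarrow> e i) \<Phi>" if "i < Suc k" for i
    using f(1)[of i] v that by (cases "i = k") auto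
  with po show ?case
    by (intro exI[of _ "\<lambda>b. (f b)(k := gs_vector b \<sigma> k (f b) (e k))"] conjI allI impI)
qed

text \<open>The vectors delivered by the process near \<open>b0\<close> satisfy the orthogonality relations with the
  same signs, and by dimension they form a Sylvester basis.\<close>

lemma openin_inertia_forms:
  fixes B :: "'v::real_inner set"
  assumes B: "finite B" "independent B" "span B = UNIV" "card B = p + q"
  shows "openin fibre_topology (inertia_forms p q (UNIV :: 'v set))"
  unfolding fibre_topology_def
proof (subst openin_subopen, intro ballI)
  fix b0 :: "'v list \<Rightarrow> real"
  assume "b0 \<in> inertia_forms p q UNIV"
  then obtain e where b0: "b0 \<in> sym_forms UNIV" and e: "sylvester_basis UNIV b0 p q e"
    by (auto simp: inertia_forms_def)
  obtain E :: "nat \<Rightarrow> 'v" where E: "frame_expansion (p + q) E" using orthonormal_frame_exists[OF B] .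
  obtain f where "\<forall>\<^sub>F b in inf (nhds b0) (principal (sym_forms UNIV)).
      pseudo_orthonormal UNIV b (inertia_sign p) (p + q) (f b)"
    using gram_schmidt_near[OF b0 E sylvester_basis_pseudo_orthonormal[OF e] inertia_sign_square order_refl]
    by auto
  then have "\<forall>\<^sub>F b in nhds b0. b \<in> sym_forms UNIV \<longrightarrow> b \<in> inertia_forms p q UNIV"
    unfolding eventually_inf_principal
    by (rule eventually_mono)
      (use pseudo_orthonormal_sylvester_basis[of _ UNIV B p q] B in \<open>auto simp: inertia_forms_def\<close>)
  then obtain T where T: "open T" "b0 \<in> T" "\<And>b. b \<in> T \<Longrightarrow> b \<in> sym_forms UNIV \<Longrightarrow> b \<in> inertia_forms p q UNIV"
    by (auto simp: eventually_nhds)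
  then show "\<exists>T. openin (top_of_set (sym_forms UNIV)) T \<and> b0 \<in> T \<and> T \<subseteq> inertia_forms p q UNIV"
    using b0 by (intro exI[of _ "sym_forms UNIV \<inter> T"]) auto
qed


section \<open>Calculus on relatively open subsets of half-spaces\<close>

text \<open>The case \<open>e = 0\<close> covers the open subsets of the model space.\<close>

definition half_space_domain :: "'v::real_inner set \<Rightarrow> bool"
  where "half_space_domain S \<longleftrightarrow> (\<exists>e. openin (top_of_set {y. 0 \<le> e \<bullet> y}) S)"

lemma half_space_domain_openin:
  assumes "half_space_domain S" "openin (top_of_set S) T"
  shows "half_space_domain T"
  using assms openin_trans unfolding half_space_domain_def by blast

text \<open>Of the two opposite directions \<open>u\<close> and \<open>- u\<close> at least one does not decrease \<open>e \<bullet> y\<close>; small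
  steps stay in the open set that cuts out \<open>S\<close>.\<close>

lemma half_space_domain_direction:
  fixes u :: "'v::real_inner"
  assumes S: "half_space_domain S" and y: "y \<in> S"
  obtains s :: real where "s \<noteq> 0" "\<forall>\<^sub>F t in at_right 0. y + (t * s) *\<^sub>R u \<in> S"
proof -
  obtain e T where T: "open T" "S = {y. 0 \<le> e \<bullet> y} \<inter> T"
    using S by (auto simp: half_space_domain_def openin_open)
  \<comment> \<open>the sign for which \<open>s *\<^sub>R u\<close> does not point out of the half-space\<close>
  define s :: real where "s = (if e \<bullet> u \<ge> 0 then 1 else -1)"
  have s: "s \<noteq> 0" "0 \<le> s * (e \<bullet> u)" by (auto simp: s_def)
  have "((\<lambda>t. y + (t * s) *\<^sub>R u) \<longlongrightarrow> y + (0 * s) *\<^sub>R u) (at_right 0)"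
    by (intro tendsto_intros)
  then have "\<forall>\<^sub>F t in at_right 0. y + (t * s) *\<^sub>R u \<in> T"
    using T y by (intro topological_tendstoD) auto
  moreover have "\<forall>\<^sub>F t in at_right (0::real). 0 < t" by (rule eventually_at_right_less)
  ultimately have "\<forall>\<^sub>F t in at_right 0. y + (t * s) *\<^sub>R u \<in> S"
  proof eventually_elim
    case (elim t)
    have "0 \<le> e \<bullet> y" using T y by auto
    moreover have "0 \<le> t * (s * (e \<bullet> u))" using mult_nonneg_nonneg[OF less_imp_le s(2)] elim by blast
    ultimately show ?case using elim T by (simp add: inner_add_right mult.assoc)
  qed
  with s(1) show ?thesis by (rule that)
qed

text \<open>Along the ray \<open>t \<mapsto> y + (t * s) *\<^sub>R u\<close> the difference quotient of the zero function is a fixed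
  multiple of \<open>D u\<close>, and it has to tend to \<open>0\<close>.\<close>

lemma has_derivative_zero_unique:
  fixes D :: "'v::real_inner \<Rightarrow> 'w::real_normed_vector"
  assumes D: "((\<lambda>_. 0) has_derivative D) (at y within S)"
    and S: "half_space_domain S" and y: "y \<in> S"
  shows "D u = 0"
proof (cases "u = 0")
  case True
  then show ?thesis using D by (simp add: has_derivative_bounded_linear linear_0 bounded_linear.linear)
next
  case False
  have lin: "linear D" using D by (simp add: has_derivative_bounded_linear bounded_linear.linear)
  obtain s :: real where s: "s \<noteq> 0" "\<forall>\<^sub>F t in at_right 0. y + (t * s) *\<^sub>R u \<in> S"
    using half_space_domain_direction[OF S y] .
  have "filterlim (\<lambda>t. y + (t * s) *\<^sub>R u) (at y within S) (at_right 0)"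
    unfolding filterlim_at
  proof
    have "\<forall>\<^sub>F t in at_right (0::real). 0 < t" by (rule eventually_at_right_less)
    with s(2) show "\<forall>\<^sub>F t in at_right 0. y + (t * s) *\<^sub>R u \<in> S \<and> y + (t * s) *\<^sub>R u \<noteq> y"
      by eventually_elim (use s(1) False in auto)
    have "((\<lambda>t. y + (t * s) *\<^sub>R u) \<longlongrightarrow> y + (0 * s) *\<^sub>R u) (at_right 0)"
      by (intro tendsto_intros)
    then show "((\<lambda>t. y + (t * s) *\<^sub>R u) \<longlongrightarrow> y) (at_right 0)" by simp
  qed
  moreover have "((\<lambda>z. ((0 - 0) - D (z - y)) /\<^sub>R norm (z - y)) \<longlongrightarrow> 0) (at y within S)"
    using D by (simp add: has_derivative_at_within)
  ultimately have "((\<lambda>t. ((0 - 0) - D (y + (t * s) *\<^sub>R u - y)) /\<^sub>R norm (y + (t * s) *\<^sub>R u - y)) \<longlongrightarrow> 0) (at_right 0)"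
    by (rule filterlim_compose[rotated])
  moreover have "\<forall>\<^sub>F t in at_right (0::real). ((0 - 0) - D (y + (t * s) *\<^sub>R u - y)) /\<^sub>R norm (y + (t * s) *\<^sub>R u - y) =
      - (s / (\<bar>s\<bar> * norm u)) *\<^sub>R D u"
    using eventually_at_right_less[of "0::real"]
  proof eventually_elim
    case (elim t)
    then have N: "norm ((t * s) *\<^sub>R u) = t * (\<bar>s\<bar> * norm u)" by (simp add: abs_mult)
    show ?case
      unfolding add_diff_cancel_left' N linear_scale[OF lin] using elim by (simp add: divide_inverse)
  qed
  ultimately have "((\<lambda>t. - (s / (\<bar>s\<bar> * norm u)) *\<^sub>R D u) \<longlongrightarrow> 0) (at_right (0::real))"
    by (rule Lim_transform_eventually)
  then show ?thesis using s(1) False by (simp add: tendsto_const_iff)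
qed

lemma frechet_derivative_within_eq:
  fixes f :: "'v::real_inner \<Rightarrow> 'w::real_normed_vector"
  assumes D: "(f has_derivative D) (at y within S)" and S: "half_space_domain S" and y: "y \<in> S"
  shows "frechet_derivative f (at y within S) = D"
proof
  fix u
  have "(f has_derivative frechet_derivative f (at y within S)) (at y within S)"
    using D frechet_derivative_works differentiableI by blast
  from has_derivative_diff[OF this D]
  have "frechet_derivative f (at y within S) u - D u = 0"
    by (intro has_derivative_zero_unique[OF _ S y]) simp
  then show "frechet_derivative f (at y within S) u = D u" by simp
qed

lemma at_within_relative_nhd:
  assumes "open W" "y \<in> W"
  shows "at y within W \<inter> S = at y within S"
  using assms by (intro at_within_nhd[of y W]) auto

text \<open>A smooth local extension of \<open>f\<close> has a continuous derivative; by uniqueness this is the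
  derivative of \<open>f\<close> within \<open>S\<close>, whichever extension is chosen.\<close>

lemma smooth_on_local_derivative:
  fixes f :: "'v::real_inner \<Rightarrow> 'w::real_normed_vector"
  assumes f: "smooth_on f S" and S: "half_space_domain S" and y: "y \<in> S"
  obtains W f' where "open W" "y \<in> W" "\<And>u. continuous_on W (\<lambda>x. f' x u)"
    "\<And>x. x \<in> W \<inter> S \<Longrightarrow> (f has_derivative f' x) (at x within S)"
    "\<And>x. x \<in> W \<inter> S \<Longrightarrow> frechet_derivative f (at x within S) = f' x"
proof -
  obtain W F where W: "open W" "y \<in> W" "Ck_on (Suc 0) F W" "\<And>x. x \<in> W \<inter> S \<Longrightarrow> F x = f x"
    using f y unfolding smooth_on_def by meson
  then obtain f' where f': "\<And>x. x \<in> W \<Longrightarrow> (F has_derivative f' x) (at x)"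
    "\<And>u. continuous_on W (\<lambda>x. f' x u)" by auto
  have D: "(f has_derivative f' x) (at x within S)" if "x \<in> W \<inter> S" for x
  proof -
    have "(F has_derivative f' x) (at x within W \<inter> S)"
      using f'(1)[of x] that by (auto intro: has_derivative_at_withinI)
    then have "(f has_derivative f' x) (at x within W \<inter> S)"
      using W(4) that by (rule_tac has_derivative_transform) auto
    then show ?thesis using W that by (simp add: at_within_relative_nhd)
  qed
  show ?thesis
    using that[OF W(1,2) f'(2) D] frechet_derivative_within_eq[OF D S] by auto
qed

lemma smooth_on_has_derivative:
  fixes f :: "'v::real_inner \<Rightarrow> 'w::real_normed_vector"
  assumes "smooth_on f S" "half_space_domain S" "y \<in> S"
  shows "(f has_derivative frechet_derivative f (at y within S)) (at y within S)"
  by (rule smooth_on_local_derivative[OF assms]) (use assms in auto)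

lemma continuous_on_frechet_derivative:
  fixes f :: "'v::real_inner \<Rightarrow> 'w::real_normed_vector"
  assumes f: "smooth_on f S" and S: "half_space_domain S"
  shows "continuous_on S (\<lambda>y. frechet_derivative f (at y within S) u)"
  unfolding continuous_on_eq_continuous_within
proof
  fix y assume y: "y \<in> S"
  obtain W f' where W: "open W" "y \<in> W" "\<And>u. continuous_on W (\<lambda>x. f' x u)"
    "\<And>x. x \<in> W \<inter> S \<Longrightarrow> frechet_derivative f (at x within S) = f' x"
    using smooth_on_local_derivative[OF f S y] by metis
  have "continuous_on (W \<inter> S) (\<lambda>x. f' x u)" using W(3) continuous_on_subset by blast
  then have "continuous_on (W \<inter> S) (\<lambda>x. frechet_derivative f (at x within S) u)"
    by (rule continuous_on_eq) (simp add: W(4))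
  then have "continuous (at y within W \<inter> S) (\<lambda>x. frechet_derivative f (at x within S) u)"
    using W(2) y by (simp add: continuous_on_eq_continuous_within)
  then show "continuous (at y within S) (\<lambda>x. frechet_derivative f (at x within S) u)"
    using W(1,2) by (simp add: at_within_relative_nhd)
qed

lemma smooth_on_imp_continuous_on:
  assumes f: "smooth_on f S"
  shows "continuous_on S f"
  unfolding continuous_on_eq_continuous_within
proof
  fix y assume y: "y \<in> S"
  obtain W F where W: "open W" "y \<in> W" "Ck_on 0 F W" "\<And>x. x \<in> W \<inter> S \<Longrightarrow> F x = f x"
    using f y unfolding smooth_on_def by meson
  have "continuous_on (W \<inter> S) F" using W(3) continuous_on_subset[of W F "W \<inter> S"] by simp
  then have "continuous_on (W \<inter> S) f"
    by (rule continuous_on_eq) (simp add: W(4))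
  then have "continuous (at y within W \<inter> S) f"
    using W(2) y by (simp add: continuous_on_eq_continuous_within)
  then show "continuous (at y within S) f"
    using W(1,2) by (simp add: at_within_relative_nhd)
qed

text \<open>The two functions come with different domains, since smooth local extensions of two functions
  need not be defined on the same open set.\<close>

lemma Ck_on_linear_combination:
  assumes "Ck_on k f W" "Ck_on k g W'"
  shows "Ck_on k (\<lambda>x. a *\<^sub>R f x + b *\<^sub>R g x) (W \<inter> W')"
  using assms
proof (induction k arbitrary: f g)
  case 0
  then show ?case
    by (auto intro!: continuous_intros intro: continuous_on_subset)
next
  case (Suc k)
  obtain f' where f': "\<forall>x\<in>W. (f has_derivative f' x) (at x)" "\<forall>u. Ck_on k (\<lambda>x. f' x u) W"
    using Suc.prems(1) by auto
  obtain g' where g': "\<forall>x\<in>W'. (g has_derivative g' x) (at x)" "\<forall>u. Ck_on k (\<lambda>x. g' x u) W'"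
    using Suc.prems(2) by auto
  show ?case
    unfolding Ck_on.simps
  proof (intro exI[of _ "\<lambda>x u. a *\<^sub>R f' x u + b *\<^sub>R g' x u"] conjI ballI allI)
    fix x assume "x \<in> W \<inter> W'"
    then show "((\<lambda>x. a *\<^sub>R f x + b *\<^sub>R g x) has_derivative (\<lambda>u. a *\<^sub>R f' x u + b *\<^sub>R g' x u)) (at x)"
      using f' g' by (auto intro!: derivative_intros)
  qed (use f'(2) g'(2) Suc.IH in blast)
qed

lemma smooth_on_linear_combination:
  assumes f: "smooth_on f S" and g: "smooth_on g S"
  shows "smooth_on (\<lambda>x. a *\<^sub>R f x + b *\<^sub>R g x) S"
  unfolding smooth_on_def
proof
  fix x assume x: "x \<in> S"
  obtain W F where W: "open W" "x \<in> W" "\<forall>k. Ck_on k F W" "\<forall>y\<in>W \<inter> S. F y = f y"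
    using f x unfolding smooth_on_def by meson
  obtain W' G where W': "open W'" "x \<in> W'" "\<forall>k. Ck_on k G W'" "\<forall>y\<in>W' \<inter> S. G y = g y"
    using g x unfolding smooth_on_def by meson
  show "\<exists>W F. open W \<and> x \<in> W \<and> (\<forall>k. Ck_on k F W) \<and> (\<forall>y\<in>W \<inter> S. F y = a *\<^sub>R f y + b *\<^sub>R g y)"
    using W W' Ck_on_linear_combination[of _ F W G W' a b]
    by (intro exI[of _ "W \<inter> W'"] exI[of _ "\<lambda>x. a *\<^sub>R F x + b *\<^sub>R G x"]) auto
qed

section \<open>Tangent spaces\<close>

locale smooth_mfd =
  fixes n :: nat and M :: "('a, 'v::real_inner) manifold"
  assumes smooth_manifold: "smooth_manifold n M"
begin

lemma model_basis:
  obtains B :: "'v set" where "finite B" "independent B" "span B = UNIV" "card B = n"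
  using smooth_manifold unfolding smooth_manifold_def by blast

lemma chart_open: "c \<in> atlas M \<Longrightarrow> openin (mtop M) (fst c)"
  using smooth_manifold unfolding smooth_manifold_def is_chart_def by blast

lemma chart_subset: "c \<in> atlas M \<Longrightarrow> fst c \<subseteq> topspace (mtop M)"
  using chart_open openin_subset by blast

lemma charts_cover: "x \<in> topspace (mtop M) \<Longrightarrow> \<exists>c. c \<in> charts_at M x"
  using smooth_manifold unfolding smooth_manifold_def charts_at_def by blast

lemma charts_atD: "c \<in> charts_at M x \<Longrightarrow> c \<in> atlas M" "c \<in> charts_at M x \<Longrightarrow> x \<in> fst c"
  by (auto simp: charts_at_def)

lemma charts_at_topspace: "c \<in> charts_at M x \<Longrightarrow> x \<in> topspace (mtop M)"
  using charts_atD chart_subset by blast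

lemma chart_homeomorphic:
  "c \<in> atlas M \<Longrightarrow> homeomorphic_map (subtopology (mtop M) (fst c)) (top_of_set (chart_image c)) (snd c)"
  using smooth_manifold unfolding smooth_manifold_def is_chart_def by blast

lemma chart_domain: "c \<in> atlas M \<Longrightarrow> half_space_domain (chart_image c)"
  using smooth_manifold unfolding smooth_manifold_def is_chart_def half_space_domain_def by blast

lemma chart_continuous:
  assumes "c \<in> atlas M"
  shows "continuous_map (subtopology (mtop M) (fst c)) (top_of_set (chart_image c)) (snd c)"
  using homeomorphic_imp_continuous_map[OF chart_homeomorphic[OF assms]] .

lemma chart_inj:
  assumes "c \<in> atlas M"
  shows "inj_on (snd c) (fst c)"
  using homeomorphic_imp_injective_map[OF chart_homeomorphic[OF assms]] chart_subset[OF assms]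
  by (simp add: Int_absorb1)

lemma chart_inv_left [simp]: "c \<in> atlas M \<Longrightarrow> x \<in> fst c \<Longrightarrow> chart_inv c (snd c x) = x"
  unfolding chart_inv_def by (simp add: chart_inj)

lemma chart_image_domain:
  assumes "c \<in> atlas M" "openin (mtop M) U" "U \<subseteq> fst c"
  shows "half_space_domain (snd c ` U)"
proof -
  have "openin (subtopology (mtop M) (fst c)) U"
    using assms by (simp add: openin_open_subtopology chart_open)
  then have "openin (top_of_set (chart_image c)) (snd c ` U)"
    using homeomorphic_imp_open_map[OF chart_homeomorphic[OF assms(1)]] by (auto simp: open_map_def)
  then show ?thesis using chart_domain[OF assms(1)] half_space_domain_openin by blast
qed

lemma overlap_domain:
  assumes "c \<in> atlas M" "d \<in> atlas M"
  shows "half_space_domain (snd c ` (fst c \<inter> fst d))"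
  using assms by (intro chart_image_domain openin_Int chart_open) auto

lemma transition_smooth:
  assumes "c \<in> atlas M" "d \<in> atlas M"
  shows "smooth_on (snd d \<circ> chart_inv c) (snd c ` (fst c \<inter> fst d))"
  using smooth_manifold assms unfolding smooth_manifold_def by blast

lemma trans_deriv_has_derivative:
  assumes "c \<in> charts_at M x" "d \<in> charts_at M x"
  shows "(snd d \<circ> chart_inv c has_derivative trans_deriv c d x)
    (at (snd c x) within snd c ` (fst c \<inter> fst d))"
  unfolding trans_deriv_def using assms
  by (intro smooth_on_has_derivative transition_smooth overlap_domain) (auto dest: charts_atD)

lemma trans_deriv_linear:
  assumes "c \<in> charts_at M x" "d \<in> charts_at M x"
  shows "linear (trans_deriv c d x)"
  using trans_deriv_has_derivative[OF assms] has_derivative_bounded_linear bounded_linear.linear by blast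

text \<open>A transition derivative can be computed on any smaller open set \<open>U\<close>, since the image of \<open>U\<close> is
  still a half-space domain. The chain rule needs this: composites of transition maps are
  only defined on triple overlaps.\<close>

lemma trans_deriv_unique:
  assumes cd: "c \<in> charts_at M x" "d \<in> charts_at M x"
    and U: "openin (mtop M) U" "x \<in> U" "U \<subseteq> fst c \<inter> fst d"
    and D: "(f has_derivative D) (at (snd c x) within snd c ` U)"
    and f: "\<And>y. y \<in> U \<Longrightarrow> f (snd c y) = snd d y"
  shows "trans_deriv c d x = D"
proof -
  have c: "c \<in> atlas M" using cd charts_atD by blast
  have S: "half_space_domain (snd c ` U)" using U by (intro chart_image_domain[OF c]) auto
  have x: "snd c x \<in> snd c ` U" using U by blast
  have "(snd d \<circ> chart_inv c has_derivative trans_deriv c d x) (at (snd c x) within snd c ` U)"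
    by (rule has_derivative_subset[OF trans_deriv_has_derivative[OF cd]]) (use U in auto)
  then have "(f has_derivative trans_deriv c d x) (at (snd c x) within snd c ` U)"
    by (rule has_derivative_transform[OF x, rotated]) (use U f c in auto)
  from frechet_derivative_within_eq[OF this S x] frechet_derivative_within_eq[OF D S x]
  show ?thesis by simp
qed

lemma trans_deriv_self:
  assumes c: "c \<in> charts_at M x"
  shows "trans_deriv c c x u = u"
  using trans_deriv_unique[OF c c chart_open[OF charts_atD(1)[OF c]], of "\<lambda>y. y" "\<lambda>u. u"]
    charts_atD[OF c] by simp

lemma trans_deriv_cocycle:
  assumes c: "c \<in> charts_at M x" and d: "d \<in> charts_at M x" and e: "e \<in> charts_at M x"
  shows "trans_deriv d e x (trans_deriv c d x u) = trans_deriv c e x u"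
proof -
  let ?U = "fst c \<inter> fst d \<inter> fst e"
  note at = charts_atD[OF c] charts_atD[OF d] charts_atD[OF e]
  have "(snd d \<circ> chart_inv c has_derivative trans_deriv c d x) (at (snd c x) within snd c ` ?U)"
    by (rule has_derivative_subset[OF trans_deriv_has_derivative[OF c d]]) auto
  moreover have "(snd e \<circ> chart_inv d has_derivative trans_deriv d e x)
      (at ((snd d \<circ> chart_inv c) (snd c x)) within (snd d \<circ> chart_inv c) ` snd c ` ?U)"
  proof -
    have "(snd d \<circ> chart_inv c) (snd c y) = snd d y" if "y \<in> fst c" for y
      using at that by simp
    then have "(snd d \<circ> chart_inv c) (snd c x) = snd d x"
      "(snd d \<circ> chart_inv c) ` snd c ` ?U = snd d ` ?U"
      using at by (auto simp: image_image)
    moreover have "(snd e \<circ> chart_inv d has_derivative trans_deriv d e x) (at (snd d x) within snd d ` ?U)"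
      by (rule has_derivative_subset[OF trans_deriv_has_derivative[OF d e]]) auto
    ultimately show ?thesis by simp
  qed
  ultimately have "((snd e \<circ> chart_inv d) \<circ> (snd d \<circ> chart_inv c) has_derivative
      trans_deriv d e x \<circ> trans_deriv c d x) (at (snd c x) within snd c ` ?U)"
    by (rule diff_chain_within)
  then have "trans_deriv c e x = trans_deriv d e x \<circ> trans_deriv c d x"
    using at by (intro trans_deriv_unique[OF c e, of ?U]) (auto intro!: openin_Int chart_open)
  then show ?thesis by simp
qed

lemma trans_deriv_continuous:
  assumes c: "c \<in> atlas M" and d: "d \<in> atlas M"
  shows "continuous_map (subtopology (mtop M) (fst c \<inter> fst d)) euclidean (\<lambda>x. trans_deriv c d x u)"
proof -
  let ?S = "snd c ` (fst c \<inter> fst d)"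
  have "continuous_map (subtopology (mtop M) (fst c \<inter> fst d)) (top_of_set (chart_image c)) (snd c)"
    using continuous_map_from_subtopology_mono[OF chart_continuous[OF c]] by auto
  then have "continuous_map (subtopology (mtop M) (fst c \<inter> fst d)) (top_of_set ?S) (snd c)"
    by (auto simp: continuous_map_in_subtopology)
  moreover have "continuous_map (top_of_set ?S) euclidean
      (\<lambda>y. frechet_derivative (snd d \<circ> chart_inv c) (at y within ?S) u)"
    using continuous_on_frechet_derivative[OF transition_smooth[OF c d] overlap_domain[OF c d]]
    by simp
  ultimately show ?thesis
    using continuous_map_compose unfolding trans_deriv_def comp_def by fast
qed

lemma coord_vec_linear:
  assumes "c \<in> charts_at M x"
  shows "linear (coord_vec M c x)"
proof (rule linearI)
  fix u v :: 'v and a :: real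
  show "coord_vec M c x (u + v) = coord_vec M c x u + coord_vec M c x v"
    using trans_deriv_linear[OF assms] by (auto simp: coord_vec_def plus_fun_def linear_add)
  show "coord_vec M c x (a *\<^sub>R u) = a *\<^sub>R coord_vec M c x u"
    using trans_deriv_linear[OF assms] by (auto simp: coord_vec_def scaleR_fun_def linear_scale)
qed

text \<open>The cocycle condition is exactly the transformation law of tangent vectors.\<close>

lemma coord_vec_tangent:
  assumes "c \<in> charts_at M x"
  shows "coord_vec M c x u \<in> tangent_space M x"
  using assms by (auto simp: tangent_space_def coord_vec_def trans_deriv_cocycle)

lemma coord_vec_apply:
  assumes "c \<in> charts_at M x"
  shows "coord_vec M c x u c = u"
  using assms by (simp add: coord_vec_def trans_deriv_self)

lemma coord_vec_of_tangent:
  assumes "c \<in> charts_at M x" "\<xi> \<in> tangent_space M x"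
  shows "coord_vec M c x (\<xi> c) = \<xi>"
proof
  fix d
  show "coord_vec M c x (\<xi> c) d = \<xi> d"
  proof (cases "d \<in> charts_at M x")
    case True
    then have "\<xi> d = trans_deriv c d x (\<xi> c)" using assms unfolding tangent_space_def by blast
    with True show ?thesis by (simp add: coord_vec_def)
  next
    case False
    then have "\<xi> d = 0" using assms(2) unfolding tangent_space_def by blast
    with False show ?thesis by (simp add: coord_vec_def)
  qed
qed

lemma range_coord_vec:
  assumes "c \<in> charts_at M x"
  shows "range (coord_vec M c x) = tangent_space M x"
proof
  show "tangent_space M x \<subseteq> range (coord_vec M c x)"
    using coord_vec_of_tangent[OF assms, symmetric] by blast
qed (use coord_vec_tangent[OF assms] in blast)

lemma coord_vec_change_chart:
  assumes "c \<in> charts_at M x" "d \<in> charts_at M x"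
  shows "coord_vec M d x (trans_deriv c d x u) = coord_vec M c x u"
  using assms by (auto simp: coord_vec_def trans_deriv_cocycle)

lemma tangent_subspace:
  assumes "x \<in> topspace (mtop M)"
  shows "subspace (tangent_space M x)"
proof -
  obtain c where c: "c \<in> charts_at M x" using charts_cover[OF assms] by blast
  show ?thesis
    using linear_subspace_image[OF coord_vec_linear[OF c] subspace_UNIV] range_coord_vec[OF c] by simp
qed

lemma tangent_basis:
  assumes "x \<in> topspace (mtop M)"
  obtains B where "finite B" "independent B" "span B = tangent_space M x" "card B = n"
proof -
  obtain c where c: "c \<in> charts_at M x" using charts_cover[OF assms] by blast
  obtain B :: "'v set" where B: "finite B" "independent B" "span B = UNIV" "card B = n"
    using model_basis .
  have inj: "inj_on (coord_vec M c x) S" for S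
    by (rule inj_on_inverseI[of _ "\<lambda>\<xi>. \<xi> c"]) (rule coord_vec_apply[OF c])
  show ?thesis
  proof (rule that)
    show "finite (coord_vec M c x ` B)" using B by simp
    show "independent (coord_vec M c x ` B)"
      using coord_vec_linear[OF c] B inj by (intro linear_independent_injective_image)
    show "span (coord_vec M c x ` B) = tangent_space M x"
      using linear_span_image[OF coord_vec_linear[OF c]] B range_coord_vec[OF c] by simp
    show "card (coord_vec M c x ` B) = n" using B inj by (simp add: card_image)
  qed
qed

end

section \<open>The topology of the bundle of symmetric forms\<close>

text \<open>Openness over different chart domains becomes comparable in the product with the whole base.\<close>

lemma openin_prod_open_subtopology:
  assumes "openin X U"
  shows "openin (prod_topology (subtopology X U) Y) W \<longleftrightarrow>
    openin (prod_topology X Y) W \<and> W \<subseteq> U \<times> topspace Y"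
proof -
  have "openin (prod_topology X Y) (U \<times> topspace Y)"
    using assms by (simp add: openin_prod_Times_iff)
  then show ?thesis
    by (simp add: prod_topology_subtopology openin_open_subtopology)
qed

lemma topspace_fibre_topology [simp]: "topspace fibre_topology = sym_forms UNIV"
  by (simp add: fibre_topology_def)

lemma continuous_map_into_fibre:
  "continuous_map Z fibre_topology f \<longleftrightarrow>
    continuous_map Z euclidean f \<and> f \<in> topspace Z \<rightarrow> sym_forms UNIV"
  unfolding fibre_topology_def by (simp add: continuous_map_in_subtopology image_subset_iff_funcset)

context smooth_mfd
begin

lemma S2T_over_iff: "(x, b) \<in> S2T_over M U \<longleftrightarrow>
    x \<in> topspace (mtop M) \<and> b \<in> sym_forms (tangent_space M x) \<and> x \<in> U"
  by (auto simp: S2T_over_def S2T_def)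

text \<open>The inverse of the local trivialization on the fibre over \<open>x\<close>: arguments are replaced by their
  coordinates in the chart \<open>c\<close>.\<close>

definition coord_form :: "('a, 'v) chart \<Rightarrow> 'a \<Rightarrow> ('v list \<Rightarrow> real) \<Rightarrow> ('a, 'v) tvec list \<Rightarrow> real"
  where "coord_form c x \<beta> =
    (\<lambda>vs. if set vs \<subseteq> tangent_space M x then \<beta> (map (\<lambda>\<xi>. \<xi> c) vs) else 0)"

lemma linear_eval: "linear (\<lambda>\<xi> :: ('a, 'v) tvec. \<xi> c)"
  by (rule linearI) (simp_all add: scaleR_fun_def)

lemma triv_sym_form:
  assumes "c \<in> charts_at M x" "b \<in> sym_forms (tangent_space M x)"
  shows "(\<lambda>us. b (map (coord_vec M c x) us)) \<in> sym_forms UNIV"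
  using pullback_sym_form[OF assms(2) tangent_subspace[OF charts_at_topspace[OF assms(1)]]
      subspace_UNIV coord_vec_linear[OF assms(1)] coord_vec_tangent[OF assms(1)]]
  by simp

lemma coord_form_sym_form:
  assumes "c \<in> charts_at M x" "\<beta> \<in> sym_forms UNIV"
  shows "coord_form c x \<beta> \<in> sym_forms (tangent_space M x)"
  using pullback_sym_form[OF assms(2) subspace_UNIV tangent_subspace[OF charts_at_topspace[OF assms(1)]]
      linear_eval[of c]]
  by (simp add: coord_form_def)

lemma triv_coord_form:
  assumes "c \<in> charts_at M x"
  shows "S2T_triv M c (x, coord_form c x \<beta>) = (x, \<beta>)"
proof -
  have "map (\<lambda>\<xi>. \<xi> c) (map (coord_vec M c x) us) = us" for us
    by (simp add: comp_def coord_vec_apply[OF assms])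
  moreover have "set (map (coord_vec M c x) us) \<subseteq> tangent_space M x" for us
    using coord_vec_tangent[OF assms] by auto
  ultimately show ?thesis unfolding S2T_triv_def coord_form_def by simp
qed

lemma coord_form_triv:
  assumes "c \<in> charts_at M x" "b \<in> sym_forms (tangent_space M x)"
  shows "coord_form c x (\<lambda>us. b (map (coord_vec M c x) us)) = b"
proof
  fix vs
  show "coord_form c x (\<lambda>us. b (map (coord_vec M c x) us)) vs = b vs"
  proof (cases "set vs \<subseteq> tangent_space M x")
    case True
    then have "map (coord_vec M c x) (map (\<lambda>\<xi>. \<xi> c) vs) = vs"
      unfolding map_map by (intro map_idI) (auto simp: coord_vec_of_tangent[OF assms(1)])
    then show ?thesis using True by (simp add: coord_form_def)
  next
    case False
    then show ?thesis using sym_forms_zero[OF assms(2), of vs] by (simp add: coord_form_def)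
  qed
qed

lemma triv_inj:
  assumes "c \<in> atlas M"
  shows "inj_on (S2T_triv M c) (S2T_over M (fst c))"
proof (rule inj_on_inverseI[where g = "\<lambda>(x, \<beta>). (x, coord_form c x \<beta>)"])
  fix z assume "z \<in> S2T_over M (fst c)"
  moreover obtain x b where z: "z = (x, b)" by (cases z)
  ultimately have "c \<in> charts_at M x" "b \<in> sym_forms (tangent_space M x)"
    using assms by (auto simp: S2T_over_iff charts_at_def)
  then show "(\<lambda>(x, \<beta>). (x, coord_form c x \<beta>)) (S2T_triv M c z) = z"
    by (simp add: z S2T_triv_def coord_form_triv)
qed

lemma triv_image:
  assumes c: "c \<in> atlas M" and U: "U \<subseteq> fst c"
  shows "S2T_triv M c ` S2T_over M U = U \<times> sym_forms UNIV"
proof (intro equalityI subsetI)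
  fix y assume "y \<in> S2T_triv M c ` S2T_over M U"
  then obtain x b where "y = S2T_triv M c (x, b)" "(x, b) \<in> S2T_over M U" by auto
  moreover from this have "c \<in> charts_at M x" using c U by (auto simp: S2T_over_iff charts_at_def)
  ultimately show "y \<in> U \<times> sym_forms UNIV"
    by (auto simp: S2T_over_iff S2T_triv_def triv_sym_form)
next
  fix y assume "y \<in> U \<times> sym_forms (UNIV :: 'v set)"
  then obtain x \<beta> where y: "y = (x, \<beta>)" "x \<in> U" "\<beta> \<in> sym_forms UNIV" by auto
  then have cx: "c \<in> charts_at M x" using c U by (auto simp: charts_at_def)
  have "(x, coord_form c x \<beta>) \<in> S2T_over M U"
    using y cx by (simp add: S2T_over_iff coord_form_sym_form charts_at_topspace)
  then show "y \<in> S2T_triv M c ` S2T_over M U"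
    using triv_coord_form[OF cx, of \<beta>] y(1) by (metis imageI)
qed

text \<open>The change of trivialization from \<open>d\<close> to \<open>c\<close>. The derivative goes the opposite way, from
  \<open>c\<close> to \<open>d\<close>, because forms are pulled back.\<close>

definition S2T_transition ::
    "('a, 'v) chart \<Rightarrow> ('a, 'v) chart \<Rightarrow> 'a \<times> ('v list \<Rightarrow> real) \<Rightarrow> 'a \<times> ('v list \<Rightarrow> real)"
  where "S2T_transition c d = (\<lambda>(x, \<beta>). (x, \<lambda>us. \<beta> (map (trans_deriv c d x) us)))"

lemma S2T_transition_triv:
  assumes cd: "c \<in> atlas M" "d \<in> atlas M" and z: "z \<in> S2T_over M (fst c \<inter> fst d)"
  shows "S2T_transition c d (S2T_triv M d z) = S2T_triv M c z"
proof -
  obtain x b where xb: "z = (x, b)" by (cases z)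
  then have "c \<in> charts_at M x" "d \<in> charts_at M x"
    using cd z by (auto simp: S2T_over_iff charts_at_def)
  then show ?thesis
    by (simp add: xb S2T_triv_def S2T_transition_def comp_def coord_vec_change_chart)
qed

text \<open>Expanding in an orthonormal frame writes the transformed form as a polynomial in the entries
  of the transition derivative and of the form, both of which are continuous.\<close>

lemma S2T_transition_continuous:
  assumes c: "c \<in> atlas M" and d: "d \<in> atlas M"
  shows "continuous_map (prod_topology (subtopology (mtop M) (fst c \<inter> fst d)) fibre_topology)
    (prod_topology (mtop M) fibre_topology) (S2T_transition c d)"
proof -
  let ?Z = "prod_topology (subtopology (mtop M) (fst c \<inter> fst d)) (fibre_topology :: ('v list \<Rightarrow> real) topology)"
  have Z: "c \<in> charts_at M x" "d \<in> charts_at M x" "\<beta> \<in> sym_forms UNIV" if "(x, \<beta>) \<in> topspace ?Z" for x \<beta>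
    using that c d by (auto simp: charts_at_def)
  obtain B :: "'v set" where B: "finite B" "independent B" "span B = UNIV" "card B = n"
    using model_basis .
  obtain E :: "nat \<Rightarrow> 'v" where E: "frame_expansion n E" using orthonormal_frame_exists[OF B] .
  have inner: "continuous_map ?Z euclideanreal (\<lambda>z. trans_deriv c d (fst z) u \<bullet> w)" for u w
  proof -
    have "continuous_map ?Z euclidean ((\<lambda>x. trans_deriv c d x u) \<circ> fst)"
      by (intro continuous_map_compose[OF continuous_map_fst] trans_deriv_continuous[OF c d])
    moreover have "continuous_map euclidean euclideanreal (\<lambda>y :: 'v. y \<bullet> w)"
      by (auto intro!: continuous_intros)
    ultimately have "continuous_map ?Z euclideanreal ((\<lambda>y :: 'v. y \<bullet> w) \<circ> ((\<lambda>x. trans_deriv c d x u) \<circ> fst))"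
      by (rule continuous_map_compose)
    then show ?thesis by (simp add: comp_def)
  qed
  have eval: "continuous_map ?Z euclideanreal (\<lambda>z. snd z us)" for us
  proof -
    have "continuous_map (fibre_topology :: ('v list \<Rightarrow> real) topology) euclideanreal (\<lambda>\<beta>. \<beta> us)"
      unfolding fibre_topology_def
      using continuous_on_subset[OF continuous_on_product_coordinates] by simp
    then have "continuous_map ?Z euclideanreal ((\<lambda>\<beta>. \<beta> us) \<circ> snd)"
      by (rule continuous_map_compose[OF continuous_map_snd])
    then show ?thesis by (simp add: comp_def)
  qed
  have "continuous_map ?Z euclideanreal (\<lambda>z. snd z (map (trans_deriv c d (fst z)) us))" for us
  proof (cases "\<exists>u v. us = [u, v]")
    case True
    then obtain u v where us: "us = [u, v]" by blast
    have "continuous_map ?Z euclideanreal (\<lambda>z. \<Sum>i<n. \<Sum>j<n. (trans_deriv c d (fst z) u \<bullet> E i) *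
        (trans_deriv c d (fst z) v \<bullet> E j) * snd z [E i, E j])"
      by (intro continuous_map_sum continuous_map_real_mult inner eval) auto
    then show ?thesis
      by (rule continuous_map_eq)
        (use Z(3) sym_form_frame_expansion[OF _ E] in \<open>auto simp: us\<close>)
  next
    case False
    then have "length us \<noteq> 2" by (auto simp: numeral_2_eq_2 length_Suc_conv)
    then have zero: "snd z (map (trans_deriv c d (fst z)) us) = 0" if "z \<in> topspace ?Z" for z
      using that \<open>length us \<noteq> 2\<close> Z(3)[of "fst z" "snd z"]
      by (intro sym_forms_zero[of _ UNIV]) auto
    have "continuous_map ?Z euclideanreal (\<lambda>z. 0)" by simp
    then show ?thesis by (rule continuous_map_eq) (simp only: zero)
  qed
  then have "continuous_map ?Z euclidean (snd \<circ> S2T_transition c d)"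
    unfolding euclidean_product_topology[symmetric] continuous_map_componentwise_UNIV
    by (simp add: S2T_transition_def case_prod_beta)
  moreover have "(snd \<circ> S2T_transition c d) z \<in> sym_forms UNIV" if "z \<in> topspace ?Z" for z
  proof -
    obtain x \<beta> where z: "z = (x, \<beta>)" by (cases z)
    show ?thesis
      using pullback_sym_form[OF Z(3)[OF that[unfolded z]] subspace_UNIV subspace_UNIV
          trans_deriv_linear[OF Z(1,2)[OF that[unfolded z]]]]
      by (simp add: z S2T_transition_def)
  qed
  ultimately have "continuous_map ?Z fibre_topology (snd \<circ> S2T_transition c d)"
    unfolding continuous_map_into_fibre by blast
  moreover have "continuous_map ?Z (mtop M) (fst \<circ> S2T_transition c d)"
  proof -
    have "fst \<circ> S2T_transition c d = fst" by (auto simp: S2T_transition_def)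
    then show ?thesis
      using continuous_map_fst continuous_map_into_fulltopology by metis
  qed
  ultimately show ?thesis by (simp add: continuous_map_pairwise)
qed

text \<open>Trivializations commute with unions, and with intersections because they are injective; hence
  the sets with open images do form a topology.\<close>

lemma openin_S2T_topology:
  "openin (S2T_topology M) W \<longleftrightarrow> W \<subseteq> S2T M \<and>
    (\<forall>c\<in>atlas M. openin (prod_topology (subtopology (mtop M) (fst c)) fibre_topology)
       (S2T_triv M c ` (W \<inter> S2T_over M (fst c))))"
proof -
  let ?L = "\<lambda>W. W \<subseteq> S2T M \<and>
    (\<forall>c\<in>atlas M. openin (prod_topology (subtopology (mtop M) (fst c)) fibre_topology)
       (S2T_triv M c ` (W \<inter> S2T_over M (fst c))))"
  have "istopology ?L"
    unfolding istopology_def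
  proof (intro conjI allI impI)
    fix A B assume "?L A" "?L B"
    moreover have "S2T_triv M c ` (A \<inter> B \<inter> S2T_over M (fst c)) =
        S2T_triv M c ` (A \<inter> S2T_over M (fst c)) \<inter> S2T_triv M c ` (B \<inter> S2T_over M (fst c))"
      if "c \<in> atlas M" for c
      using inj_on_image_Int[OF triv_inj[OF that], of "A \<inter> S2T_over M (fst c)" "B \<inter> S2T_over M (fst c)"]
      by (simp add: Int_assoc Int_left_commute)
    ultimately show "A \<inter> B \<subseteq> S2T M"
      "\<forall>c\<in>atlas M. openin (prod_topology (subtopology (mtop M) (fst c)) fibre_topology)
         (S2T_triv M c ` (A \<inter> B \<inter> S2T_over M (fst c)))"
      by (auto simp: openin_Int)
  next
    fix \<K> assume K: "\<forall>A\<in>\<K>. ?L A"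
    then show "\<Union>\<K> \<subseteq> S2T M" by blast
    have eq: "S2T_triv M c ` (\<Union>\<K> \<inter> S2T_over M (fst c)) = (\<Union>A\<in>\<K>. S2T_triv M c ` (A \<inter> S2T_over M (fst c)))" for c
      by blast
    show "\<forall>c\<in>atlas M. openin (prod_topology (subtopology (mtop M) (fst c)) fibre_topology)
         (S2T_triv M c ` (\<Union>\<K> \<inter> S2T_over M (fst c)))"
      unfolding eq by (intro ballI openin_Union) (use K in blast)
  qed
  then show ?thesis unfolding S2T_topology_def by (simp add: topology_inverse')
qed

text \<open>For sets over a single chart domain, openness can be tested in that chart alone: the image in
  any other chart \<open>d\<close> is the preimage of the image in \<open>c\<close> under the continuous change of
  trivialization.\<close>

lemma openin_S2T_over_chart:
  assumes c: "c \<in> atlas M" and A: "A \<subseteq> S2T_over M (fst c)"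
  shows "openin (S2T_topology M) A \<longleftrightarrow>
    openin (prod_topology (subtopology (mtop M) (fst c)) fibre_topology) (S2T_triv M c ` A)"
proof
  assume "openin (S2T_topology M) A"
  moreover have "A \<inter> S2T_over M (fst c) = A" using A by blast
  ultimately show "openin (prod_topology (subtopology (mtop M) (fst c)) fibre_topology) (S2T_triv M c ` A)"
    using c by (auto simp: openin_S2T_topology)
next
  assume o: "openin (prod_topology (subtopology (mtop M) (fst c)) fibre_topology) (S2T_triv M c ` A)"
  have "openin (prod_topology (subtopology (mtop M) (fst d)) fibre_topology)
      (S2T_triv M d ` (A \<inter> S2T_over M (fst d)))" if d: "d \<in> atlas M" for d
  proof -
    let ?Z = "prod_topology (subtopology (mtop M) (fst c \<inter> fst d)) (fibre_topology :: ('v list \<Rightarrow> real) topology)"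
    have "openin ?Z {y \<in> topspace ?Z. S2T_transition c d y \<in> S2T_triv M c ` A}"
      using o chart_open[OF c]
      by (intro openin_continuous_map_preimage[OF S2T_transition_continuous[OF c d]])
        (simp add: openin_prod_open_subtopology)
    moreover have "{y \<in> topspace ?Z. S2T_transition c d y \<in> S2T_triv M c ` A} =
        S2T_triv M d ` (A \<inter> S2T_over M (fst d))"
    proof (intro equalityI subsetI)
      fix y assume "y \<in> {y \<in> topspace ?Z. S2T_transition c d y \<in> S2T_triv M c ` A}"
      then have y: "y \<in> (fst c \<inter> fst d) \<times> sym_forms UNIV" "S2T_transition c d y \<in> S2T_triv M c ` A"
        by auto
      from y(1) have "y \<in> S2T_triv M d ` S2T_over M (fst c \<inter> fst d)"
        by (simp only: triv_image[OF d Int_lower2])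
      then obtain z where z: "z \<in> S2T_over M (fst c \<inter> fst d)" "y = S2T_triv M d z" by blast
      then have "S2T_triv M c z \<in> S2T_triv M c ` A"
        using y(2) S2T_transition_triv[OF c d z(1)] by simp
      moreover have "z \<in> S2T_over M (fst c)" "z \<in> S2T_over M (fst d)"
        using z(1) by (auto simp: S2T_over_def)
      ultimately have "z \<in> A" using inj_on_image_mem_iff[OF triv_inj[OF c] _ A] by blast
      then show "y \<in> S2T_triv M d ` (A \<inter> S2T_over M (fst d))"
        using z(2) \<open>z \<in> S2T_over M (fst d)\<close> by blast
    next
      fix y assume "y \<in> S2T_triv M d ` (A \<inter> S2T_over M (fst d))"
      then obtain z where z: "z \<in> A" "z \<in> S2T_over M (fst d)" "y = S2T_triv M d z" by blast
      then have z': "z \<in> S2T_over M (fst c \<inter> fst d)" using A by (auto simp: S2T_over_def)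
      then have "y \<in> (fst c \<inter> fst d) \<times> sym_forms UNIV"
        using triv_image[OF d, of "fst c \<inter> fst d"] z(3) by blast
      then have "y \<in> topspace ?Z" using chart_subset[OF c] by auto
      then show "y \<in> {y \<in> topspace ?Z. S2T_transition c d y \<in> S2T_triv M c ` A}"
        using S2T_transition_triv[OF c d z'] z by auto
    qed
    ultimately have "openin ?Z (S2T_triv M d ` (A \<inter> S2T_over M (fst d)))" by simp
    then show ?thesis
      using chart_open[OF c] chart_open[OF d]
      by (auto simp: openin_prod_open_subtopology openin_Int)
  qed
  moreover have "A \<subseteq> S2T M" using A by (auto simp: S2T_over_def)
  ultimately show "openin (S2T_topology M) A" by (simp add: openin_S2T_topology)
qed

lemma openin_S2T_over:
  assumes c: "c \<in> atlas M"
  shows "openin (S2T_topology M) (S2T_over M (fst c))"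
  using triv_image[OF c order_refl] chart_subset[OF c] openin_S2T_over_chart[OF c order_refl]
    openin_topspace[of "prod_topology (subtopology (mtop M) (fst c)) (fibre_topology :: ('v list \<Rightarrow> real) topology)"]
  by (simp add: Int_absorb1)

lemma triv_homeomorphic:
  assumes c: "c \<in> atlas M"
  shows "homeomorphic_map (subtopology (S2T_topology M) (S2T_over M (fst c)))
    (prod_topology (subtopology (mtop M) (fst c)) fibre_topology) (S2T_triv M c)"
proof -
  let ?X = "subtopology (S2T_topology M) (S2T_over M (fst c))"
  let ?Y = "prod_topology (subtopology (mtop M) (fst c)) (fibre_topology :: ('v list \<Rightarrow> real) topology)"
  have X: "topspace ?X = S2T_over M (fst c)"
    using openin_subset[OF openin_S2T_over[OF c]] by (simp add: Int_absorb1)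
  have Y: "topspace ?Y = fst c \<times> sym_forms UNIV"
    using chart_subset[OF c] by (simp add: Int_absorb1)
  have "openin ?X {z \<in> topspace ?X. S2T_triv M c z \<in> U} \<longleftrightarrow> openin ?Y U" if "U \<subseteq> topspace ?Y" for U
  proof -
    let ?A = "{z \<in> S2T_over M (fst c). S2T_triv M c z \<in> U}"
    have "U \<subseteq> S2T_triv M c ` S2T_over M (fst c)"
      using that unfolding Y triv_image[OF c order_refl] .
    then have "S2T_triv M c ` ?A = U" by auto
    moreover have "?A \<subseteq> S2T_over M (fst c)" by blast
    ultimately show ?thesis
      using openin_S2T_over_chart[OF c, of ?A] unfolding X openin_open_subtopology[OF openin_S2T_over[OF c]]
      by simp
  qed
  then show ?thesis
    unfolding homeomorphic_map_def quotient_map_def X Y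
    using triv_inj[OF c] triv_image[OF c order_refl] by blast
qed

text \<open>The coordinate map and its inverse, evaluation at \<open>c\<close>, are isometries between the form and its
  local representative.\<close>

lemma triv_inertia:
  assumes c: "c \<in> charts_at M x" and b: "b \<in> sym_forms (tangent_space M x)"
  shows "(\<lambda>us. b (map (coord_vec M c x) us)) \<in> inertia_forms p q UNIV \<longleftrightarrow>
    b \<in> inertia_forms p q (tangent_space M x)"
proof -
  let ?\<beta> = "\<lambda>us. b (map (coord_vec M c x) us)"
  note \<beta> = triv_sym_form[OF c b]
  note T = tangent_subspace[OF charts_at_topspace[OF c]]
  have "sylvester_basis UNIV ?\<beta> p q ((\<lambda>\<xi>. \<xi> c) \<circ> e)" if "sylvester_basis (tangent_space M x) b p q e" for e
  proof (rule linear_image_sylvester_basis[OF \<beta> subspace_UNIV linear_eval _ _ that])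
    show "(\<lambda>\<xi>. \<xi> c) ` tangent_space M x = UNIV"
      using coord_vec_tangent[OF c] coord_vec_apply[OF c] by (metis UNIV_eq_I image_eqI)
  qed (simp add: coord_vec_of_tangent[OF c])
  moreover have "sylvester_basis (tangent_space M x) b p q (coord_vec M c x \<circ> e)"
    if "sylvester_basis UNIV ?\<beta> p q e" for e
    by (rule linear_image_sylvester_basis[OF b T coord_vec_linear[OF c] range_coord_vec[OF c] _ that]) simp
  ultimately show ?thesis using b \<beta> by (auto simp: inertia_forms_def)
qed

lemma triv_inertia_bundle:
  assumes c: "c \<in> atlas M"
  shows "S2T_triv M c ` (inertia_bundle M p q \<inter> S2T_over M (fst c)) = fst c \<times> inertia_forms p q UNIV"
proof (intro equalityI subsetI)
  fix y assume "y \<in> S2T_triv M c ` (inertia_bundle M p q \<inter> S2T_over M (fst c))"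
  then obtain x b where y: "y = S2T_triv M c (x, b)" "(x, b) \<in> S2T_over M (fst c)"
    "b \<in> inertia_forms p q (tangent_space M x)" by (auto simp: inertia_bundle_def)
  then have "c \<in> charts_at M x" "b \<in> sym_forms (tangent_space M x)" "x \<in> fst c"
    using c by (auto simp: S2T_over_iff charts_at_def)
  then show "y \<in> fst c \<times> inertia_forms p q UNIV"
    using y triv_inertia by (auto simp: S2T_triv_def)
next
  fix y assume "y \<in> fst c \<times> inertia_forms p q (UNIV :: 'v set)"
  then obtain x \<beta> where y: "y = (x, \<beta>)" "x \<in> fst c" "\<beta> \<in> inertia_forms p q UNIV" by auto
  then have \<beta>: "\<beta> \<in> sym_forms UNIV" by (simp add: inertia_forms_def)
  with y obtain z where "z \<in> S2T_over M (fst c)" "y = S2T_triv M c z"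
    using triv_image[OF c order_refl] by blast
  moreover obtain b where z: "z = (x, b)"
    using calculation(2) y(1) by (cases z) (auto simp: S2T_triv_def)
  ultimately have b: "(x, b) \<in> S2T_over M (fst c)" "y = S2T_triv M c (x, b)" by auto
  then have "c \<in> charts_at M x" "b \<in> sym_forms (tangent_space M x)" "x \<in> topspace (mtop M)"
    using c by (auto simp: S2T_over_iff charts_at_def)
  moreover have "\<beta> = (\<lambda>us. b (map (coord_vec M c x) us))"
    using b(2) y(1) by (simp add: S2T_triv_def)
  ultimately have "(x, b) \<in> inertia_bundle M p q"
    using y(3) triv_inertia by (auto simp: inertia_bundle_def)
  then show "y \<in> S2T_triv M c ` (inertia_bundle M p q \<inter> S2T_over M (fst c))" using b by blast
qed

lemma inertia_bundle_subset: "inertia_bundle M p q \<subseteq> S2T M"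
  by (auto simp: inertia_bundle_def S2T_def inertia_forms_def)

theorem inertia_bundle_open_subbundle:
  assumes pq: "p + q = n"
  shows "open_subbundle M (inertia_bundle M p q)"
proof -
  obtain B :: "'v set" where B: "finite B" "independent B" "span B = UNIV" "card B = p + q"
    using model_basis pq by metis
  have F: "openin fibre_topology (inertia_forms p q (UNIV :: 'v set))"
    by (rule openin_inertia_forms[OF B])
  have "openin (prod_topology (subtopology (mtop M) (fst c)) fibre_topology)
      (fst c \<times> inertia_forms p q (UNIV :: 'v set))" if "c \<in> atlas M" for c
    using F chart_open[OF that] by (simp add: openin_prod_Times_iff openin_subtopology_self openin_open_subtopology)
  then have "openin (S2T_topology M) (inertia_bundle M p q)"
    using inertia_bundle_subset by (simp add: openin_S2T_topology triv_inertia_bundle)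
  moreover have "\<exists>c\<in>charts_at M x.
      homeomorphic_map (subtopology (S2T_topology M) (S2T_over M (fst c)))
        (prod_topology (subtopology (mtop M) (fst c)) fibre_topology) (S2T_triv M c) \<and>
      S2T_triv M c ` (inertia_bundle M p q \<inter> S2T_over M (fst c)) = fst c \<times> inertia_forms p q UNIV"
    if "x \<in> topspace (mtop M)" for x
    using charts_cover[OF that] triv_homeomorphic triv_inertia_bundle charts_atD(1) by blast
  ultimately show ?thesis unfolding open_subbundle_def using F by blast
qed

end

section \<open>Convexity of the space of metrics\<close>

lemma multilinear_forms_linear_combination:
  assumes S: "S \<in> multilinear_forms k V" and T: "T \<in> multilinear_forms k V"
  shows "a *\<^sub>R S + b *\<^sub>R T \<in> multilinear_forms k V"
proof -
  have eval: "(a *\<^sub>R S + b *\<^sub>R T) vs = a * S vs + b * T vs" for vs by (simp add: scaleR_fun_def)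
  show ?thesis
    unfolding multilinear_forms_def eval
    using multilinear_forms_zero[OF S] multilinear_forms_zero[OF T]
      multilinear_forms_slot[OF S] multilinear_forms_slot[OF T]
    by (auto simp: algebra_simps)
qed

lemma sym2_tensors_linear_combination:
  assumes "S \<in> sym2_tensors j V" "T \<in> sym2_tensors j V"
  shows "a *\<^sub>R S + b *\<^sub>R T \<in> sym2_tensors j V"
proof -
  have "(a *\<^sub>R S + b *\<^sub>R T) (us @ [v, w]) = (a *\<^sub>R S + b *\<^sub>R T) (us @ [w, v])" for us v w
  proof -
    have "S (us @ [v, w]) = S (us @ [w, v])" "T (us @ [v, w]) = T (us @ [w, v])"
      using assms unfolding sym2_tensors_def by blast+
    then show ?thesis by (simp add: scaleR_fun_def)
  qed
  then show ?thesis
    using assms multilinear_forms_linear_combination unfolding sym2_tensors_def by blast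
qed

lemma smooth_sections_linear_combination:
  assumes s: "s \<in> smooth_sections M F" and t: "t \<in> smooth_sections M F"
    and F: "\<And>x. x \<in> topspace (mtop M) \<Longrightarrow> s x \<in> F (tangent_space M x) \<Longrightarrow>
      t x \<in> F (tangent_space M x) \<Longrightarrow> a *\<^sub>R s x + b *\<^sub>R t x \<in> F (tangent_space M x)"
  shows "a *\<^sub>R s + b *\<^sub>R t \<in> smooth_sections M F"
proof -
  have eval: "(a *\<^sub>R s + b *\<^sub>R t) x = a *\<^sub>R s x + b *\<^sub>R t x" for x by (simp add: scaleR_fun_def)
  have "smooth_on (\<lambda>y. (a *\<^sub>R s + b *\<^sub>R t) (chart_inv c y) (map (coord_vec M c (chart_inv c y)) us))
      (chart_image c)" if "c \<in> atlas M" for c us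
  proof -
    have "smooth_on (\<lambda>y. a *\<^sub>R s (chart_inv c y) (map (coord_vec M c (chart_inv c y)) us) +
        b *\<^sub>R t (chart_inv c y) (map (coord_vec M c (chart_inv c y)) us)) (chart_image c)"
      using s t that unfolding smooth_sections_def by (intro smooth_on_linear_combination) blast+
    then show ?thesis by (simp add: scaleR_fun_def)
  qed
  moreover have "(a *\<^sub>R s + b *\<^sub>R t) x = 0" if "x \<notin> topspace (mtop M)" for x
    using s t that unfolding smooth_sections_def eval by simp
  moreover have "(a *\<^sub>R s + b *\<^sub>R t) x \<in> F (tangent_space M x)" if "x \<in> topspace (mtop M)" for x
    using s t that F unfolding smooth_sections_def eval by blast
  ultimately show ?thesis unfolding smooth_sections_def by blast
qed

lemma smooth_sections_sym2_linear_combination: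
  assumes "s \<in> smooth_sections M (sym2_tensors j)" "t \<in> smooth_sections M (sym2_tensors j)"
  shows "a *\<^sub>R s + b *\<^sub>R t \<in> smooth_sections M (sym2_tensors j)"
  using assms by (rule smooth_sections_linear_combination) (rule sym2_tensors_linear_combination)

lemma positive_definite_convex_combination:
  assumes "positive_definite V b0" "positive_definite V b1" "0 \<le> t" "t \<le> (1::real)"
  shows "positive_definite V ((1 - t) *\<^sub>R b0 + t *\<^sub>R b1)"
  unfolding positive_definite_def
proof (intro ballI impI)
  fix v assume "v \<in> V" "v \<noteq> 0"
  then have pos: "0 < b0 [v, v]" "0 < b1 [v, v]" using assms by (auto simp: positive_definite_def)
  have "0 < (1 - t) * b0 [v, v] + t * b1 [v, v]"
  proof (cases "t = 0")
    case False
    then show ?thesis using pos assms(3,4) by (intro add_nonneg_pos mult_nonneg_nonneg mult_pos_pos) auto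
  qed (use pos in simp)
  then show "0 < ((1 - t) *\<^sub>R b0 + t *\<^sub>R b1) [v, v]" by (simp add: scaleR_fun_def)
qed

lemma riemannian_metrics_subset: "riemannian_metrics n M \<subseteq> sym2_sections M"
  by (auto simp: riemannian_metrics_def sym2_sections_def smooth_sections_def inertia_forms_def)

context smooth_mfd
begin

lemma riemannian_metrics_convex_combination:
  assumes g: "g0 \<in> riemannian_metrics n M" "g1 \<in> riemannian_metrics n M" and t: "0 \<le> t" "t \<le> 1"
  shows "(1 - t) *\<^sub>R g0 + t *\<^sub>R g1 \<in> riemannian_metrics n M"
  using g unfolding riemannian_metrics_def
proof (rule smooth_sections_linear_combination)
  fix x assume x: "x \<in> topspace (mtop M)"
    and b: "g0 x \<in> inertia_forms n 0 (tangent_space M x)" "g1 x \<in> inertia_forms n 0 (tangent_space M x)"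
  obtain B where B: "finite B" "independent B" "span B = tangent_space M x" "card B = n"
    using tangent_basis[OF x] .
  have "positive_definite (tangent_space M x) ((1 - t) *\<^sub>R g0 x + t *\<^sub>R g1 x)"
    using b t tangent_subspace[OF x]
    by (intro positive_definite_convex_combination inertia_positive_definite)
  moreover have "(1 - t) *\<^sub>R g0 x + t *\<^sub>R g1 x \<in> sym_forms (tangent_space M x)"
    using b by (intro sym2_tensors_linear_combination) (auto simp: inertia_forms_def)
  ultimately show "(1 - t) *\<^sub>R g0 x + t *\<^sub>R g1 x \<in> inertia_forms n 0 (tangent_space M x)"
    using B by (intro positive_definite_inertia)
qed

lemma riemannian_metrics_convex: "convex (riemannian_metrics n M)"
  unfolding convex_alt using riemannian_metrics_convex_combination by blast

end


section \<open>Local boundedness of tensor norms\<close>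

text \<open>If \<open>H\<close> is the Gram matrix of a frame and \<open>a\<close> the coefficients of a unit vector, then the
  deviation of \<open>H\<close> from the identity changes the square of the vector by at most half of
  \<open>q = (\<Sum>i<n. (a i)\<^sup>2)\<close>, by \<open>2 * \<bar>x * y\<bar> \<le> x\<^sup>2 + y\<^sup>2\<close>. So \<open>q \<le> 1 + q / 2\<close>. The summand \<open>1\<close>
  in the denominator only avoids division by \<open>0\<close>.\<close>

lemma almost_orthonormal_coefficients:
  fixes H :: "nat \<Rightarrow> nat \<Rightarrow> real" and a :: "nat \<Rightarrow> real"
  assumes H: "\<And>i j. i < n \<Longrightarrow> j < n \<Longrightarrow> \<bar>H i j - (if i = j then 1 else 0)\<bar> \<le> 1 / (2 * real n + 1)"
    and a: "(\<Sum>i<n. \<Sum>j<n. a i * a j * H i j) = 1" and k: "k < n"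
  shows "\<bar>a k\<bar> \<le> 2"
proof -
  let ?\<delta> = "\<lambda>i j. if i = j then 1 else (0::real)"
  define \<epsilon> where "\<epsilon> = 1 / (2 * real n + 1)"
  define q where "q = (\<Sum>i<n. (a i)\<^sup>2)"
  have "(\<Sum>i<n. \<Sum>j<n. a i * a j * ?\<delta> i j) = (\<Sum>i<n. \<Sum>j<n. if i = j then a i * a j else 0)"
    by (intro sum.cong) auto
  also have "\<dots> = q" by (simp add: q_def power2_eq_square)
  finally have "q - 1 = (\<Sum>i<n. \<Sum>j<n. a i * a j * (?\<delta> i j - H i j))"
    using a by (simp add: right_diff_distrib sum_subtractf)
  also have "\<dots> \<le> (\<Sum>i<n. \<Sum>j<n. ((a i)\<^sup>2 + (a j)\<^sup>2) / 2 * \<epsilon>)"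
  proof (intro sum_mono)
    fix i j assume "i \<in> {..<n}" "j \<in> {..<n}"
    then have h: "\<bar>?\<delta> i j - H i j\<bar> \<le> \<epsilon>" using H[of i j] by (simp add: \<epsilon>_def abs_minus_commute)
    have "a i * a j * (?\<delta> i j - H i j) \<le> \<bar>a i * a j\<bar> * \<bar>?\<delta> i j - H i j\<bar>"
      by (metis abs_ge_self abs_mult)
    also have "\<dots> \<le> ((a i)\<^sup>2 + (a j)\<^sup>2) / 2 * \<epsilon>"
    proof (rule mult_mono[OF _ h])
      have "0 \<le> (\<bar>a i\<bar> - \<bar>a j\<bar>)\<^sup>2" by simp
      then show "\<bar>a i * a j\<bar> \<le> ((a i)\<^sup>2 + (a j)\<^sup>2) / 2"
        by (simp add: power2_diff abs_mult)
    qed auto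
    finally show "a i * a j * (?\<delta> i j - H i j) \<le> ((a i)\<^sup>2 + (a j)\<^sup>2) / 2 * \<epsilon>" .
  qed
  also have "\<dots> = real n * q * \<epsilon>"
  proof -
    have "(\<Sum>i<n. \<Sum>j<n. ((a i)\<^sup>2 + (a j)\<^sup>2) / 2 * \<epsilon>) =
        (\<Sum>i<n. \<Sum>j<n. (a i)\<^sup>2 + (a j)\<^sup>2) / 2 * \<epsilon>"
      by (simp add: sum_distrib_right sum_divide_distrib)
    also have "(\<Sum>i<n. \<Sum>j<n. (a i)\<^sup>2 + (a j)\<^sup>2) = 2 * (real n * q)"
      by (simp add: sum.distrib q_def sum_distrib_left)
    finally show ?thesis by simp
  qed
  also have "\<dots> \<le> q / 2"
  proof -
    have "real n * \<epsilon> \<le> 1 / 2" by (simp add: \<epsilon>_def field_simps)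
    moreover have "0 \<le> q" by (simp add: q_def sum_nonneg)
    ultimately have "(real n * \<epsilon>) * q \<le> 1 / 2 * q" by (rule mult_right_mono)
    then show ?thesis by (simp add: mult.commute mult.left_commute)
  qed
  finally have "q \<le> 2" by simp
  moreover have "(a k)\<^sup>2 \<le> q" unfolding q_def using k by (intro member_le_sum) auto
  ultimately have "\<bar>a k\<bar>\<^sup>2 \<le> 2\<^sup>2" by simp
  then show ?thesis by (rule power2_le_imp_le) simp
qed

text \<open>Each argument is expanded into \<open>n\<close> terms with coefficients of size at most \<open>2\<close>, one slot after
  the other from right to left.\<close>

lemma multilinear_forms_bound:
  assumes T: "T \<in> multilinear_forms k V" and V: "subspace V"
    and g: "\<And>i. i < n \<Longrightarrow> g i \<in> V"
    and C: "\<And>js. length js = k \<Longrightarrow> set js \<subseteq> {..<n} \<Longrightarrow> \<bar>T (map g js)\<bar> \<le> C"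
    and vs: "length vs = k"
      "\<And>v. v \<in> set vs \<Longrightarrow> \<exists>a. v = (\<Sum>i<n. a i *\<^sub>R g i) \<and> (\<forall>i<n. \<bar>a i\<bar> \<le> 2)"
  shows "\<bar>T vs\<bar> \<le> (2 * real n) ^ k * C"
proof -
  have "\<bar>T (vs @ map g js)\<bar> \<le> (2 * real n) ^ length vs * C"
    if "length vs + length js = k" "set js \<subseteq> {..<n}"
      "\<And>v. v \<in> set vs \<Longrightarrow> \<exists>a. v = (\<Sum>i<n. a i *\<^sub>R g i) \<and> (\<forall>i<n. \<bar>a i\<bar> \<le> 2)" for vs js
    using that
  proof (induction vs arbitrary: js rule: rev_induct)
    case Nil
    then show ?case using C[of js] by simp
  next
    case (snoc v vs)
    have inV: "(\<Sum>i<n. a i *\<^sub>R g i) \<in> V" for a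
      using g by (intro subspace_sum[OF V] subspace_mul[OF V]) auto
    obtain a where a: "v = (\<Sum>i<n. a i *\<^sub>R g i)" "\<And>i. i < n \<Longrightarrow> \<bar>a i\<bar> \<le> 2"
      using snoc.prems(3)[of v] by auto
    have vsV: "set vs \<subseteq> V"
    proof
      fix w assume "w \<in> set vs"
      then show "w \<in> V" using snoc.prems(3)[of w] inV by auto
    qed
    have "T ((vs @ [v]) @ map g js) = (\<Sum>i<n. a i * T (vs @ g i # map g js))"
      using snoc.prems g vsV multilinear_forms_slot_sum[OF T V, of vs "map g js" "{..<n}" g a]
      by (force simp: a(1))
    also have "\<bar>\<dots>\<bar> \<le> (\<Sum>i<n. \<bar>a i * T (vs @ g i # map g js)\<bar>)" by (rule sum_abs)
    also have "\<dots> \<le> (\<Sum>i<n. 2 * ((2 * real n) ^ length vs * C))"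
    proof (rule sum_mono)
      fix i assume i: "i \<in> {..<n}"
      have "\<bar>T (vs @ map g (i # js))\<bar> \<le> (2 * real n) ^ length vs * C"
        using snoc.prems i by (intro snoc.IH) auto
      then show "\<bar>a i * T (vs @ g i # map g js)\<bar> \<le> 2 * ((2 * real n) ^ length vs * C)"
        using a(2)[of i] i unfolding abs_mult by (intro mult_mono) auto
    qed
    also have "\<dots> = (2 * real n) ^ length (vs @ [v]) * C" by simp
    finally show ?case .
  qed
  from this[of vs "[]"] vs show ?thesis by simp
qed

definition index_lists :: "nat \<Rightarrow> nat \<Rightarrow> nat list set"
  where "index_lists n k = {js. length js = k \<and> set js \<subseteq> {..<n}}"

lemma finite_index_lists: "finite (index_lists n k)"
  using finite_lists_length_eq[of "{..<n}" k] by (simp add: index_lists_def conj_commute)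

text \<open>The orthonormal basis depends on the space and on \<open>b\<close> only, not on the tensor, so all three
  norms are Euclidean norms of components in one basis.\<close>

lemma tensor_norm_linear_combination:
  "tensor_norm n V b k (x *\<^sub>R S + y *\<^sub>R T) \<le> \<bar>x\<bar> * tensor_norm n V b k S + \<bar>y\<bar> * tensor_norm n V b k T"
proof -
  define e where "e = (SOME e. sylvester_basis V b n 0 e)"
  have N: "tensor_norm n V b k T = L2_set (\<lambda>js. T (map e js)) (index_lists n k)" for T
    by (simp add: tensor_norm_def e_def index_lists_def)
  have scale: "L2_set (\<lambda>js. c * f js) A = \<bar>c\<bar> * L2_set f A" for c f and A :: "nat list set"
  proof -
    have "\<bar>c\<bar> * L2_set f A = L2_set (\<lambda>js. \<bar>c\<bar> * f js) A" by (rule L2_set_right_distrib) simp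
    then show ?thesis by (simp add: L2_set_def power_mult_distrib)
  qed
  have "L2_set (\<lambda>js. x * S (map e js) + y * T (map e js)) (index_lists n k) \<le>
      L2_set (\<lambda>js. x * S (map e js)) (index_lists n k) + L2_set (\<lambda>js. y * T (map e js)) (index_lists n k)"
    by (rule L2_set_triangle_ineq)
  then show ?thesis by (simp add: N scale scaleR_fun_def)
qed

lemma locally_bounded_on_compact:
  fixes f :: "'a \<Rightarrow> real"
  assumes K: "compactin X K" and loc: "\<And>x. x \<in> K \<Longrightarrow> \<exists>C. \<forall>\<^sub>F y in nhdsin X x. f y \<le> C"
  shows "bdd_above (f ` K)"
proof -
  let ?\<U> = "{U. openin X U \<and> bdd_above (f ` U)}"
  have "K \<subseteq> \<Union>?\<U>"
  proof
    fix x assume x: "x \<in> K"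
    then obtain C where C: "\<forall>\<^sub>F y in nhdsin X x. f y \<le> C" using loc by blast
    moreover have "x \<in> topspace X" using K x compactin_subset_topspace by blast
    ultimately obtain U where U: "openin X U" "x \<in> U" "\<forall>y\<in>U. f y \<le> C"
      unfolding eventually_nhdsin by blast
    then have "bdd_above (f ` U)" by (intro bdd_aboveI[of _ C]) auto
    then show "x \<in> \<Union>?\<U>" using U by blast
  qed
  moreover have "\<forall>U\<in>?\<U>. openin X U" by blast
  ultimately obtain \<F> where F: "finite \<F>" "\<F> \<subseteq> ?\<U>" "K \<subseteq> \<Union>\<F>"
    using K unfolding compactin_def by meson
  have "bdd_above (\<Union>U\<in>\<F>. f ` U)" using F by auto
  then show ?thesis by (rule bdd_above_mono) (use F(3) in blast)
qed

context smooth_mfd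
begin

lemma section_component_continuous:
  assumes s: "s \<in> smooth_sections M F" and c: "c \<in> atlas M"
  shows "continuous_map (subtopology (mtop M) (fst c)) euclideanreal
    (\<lambda>x. s x (map (coord_vec M c x) us))"
proof -
  have "continuous_map (top_of_set (chart_image c)) euclideanreal
      (\<lambda>y. s (chart_inv c y) (map (coord_vec M c (chart_inv c y)) us))"
    using s c unfolding smooth_sections_def by (simp add: smooth_on_imp_continuous_on)
  from continuous_map_compose[OF chart_continuous[OF c] this]
  show ?thesis by (rule continuous_map_eq) (use c in simp)
qed

lemma section_component_tendsto:
  assumes s: "s \<in> smooth_sections M F" and c: "c \<in> charts_at M x0"
  shows "((\<lambda>x. s x (map (coord_vec M c x) us)) \<longlongrightarrow> s x0 (map (coord_vec M c x0) us)) (nhdsin (mtop M) x0)"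
proof (rule topological_tendstoI)
  fix S :: "real set"
  assume S: "open S" "s x0 (map (coord_vec M c x0) us) \<in> S"
  let ?X = "subtopology (mtop M) (fst c)"
  have c': "c \<in> atlas M" "x0 \<in> fst c" using charts_atD[OF c] .
  have "openin ?X {x \<in> topspace ?X. s x (map (coord_vec M c x) us) \<in> S}"
    using S by (intro openin_continuous_map_preimage[OF section_component_continuous[OF s c'(1)]]) simp
  then have "openin (mtop M) {x \<in> topspace ?X. s x (map (coord_vec M c x) us) \<in> S}"
    unfolding openin_open_subtopology[OF chart_open[OF c'(1)]] by blast
  then show "\<forall>\<^sub>F x in nhdsin (mtop M) x0. s x (map (coord_vec M c x) us) \<in> S"
    unfolding eventually_nhdsin using S(2) c' charts_at_topspace[OF c]
    by (intro disjI2 exI[of _ "{x \<in> topspace ?X. s x (map (coord_vec M c x) us) \<in> S}"]) auto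
qed

text \<open>The frame given by \<open>f\<close> is almost orthonormal for \<open>b\<close>, so the arbitrarily chosen orthonormal
  basis has coefficients of size at most \<open>2\<close> in it, and the bound does not depend on the choice.\<close>

lemma tensor_norm_bound:
  assumes T: "T \<in> multilinear_forms k (tangent_space M x)" and c: "c \<in> charts_at M x"
    and h: "b \<in> inertia_forms n 0 (tangent_space M x)"
    and f: "span (f ` {..<n}) = UNIV"
    and H: "\<And>i j. i < n \<Longrightarrow> j < n \<Longrightarrow>
      \<bar>b [coord_vec M c x (f i), coord_vec M c x (f j)] - (if i = j then 1 else 0)\<bar> \<le> 1 / (2 * real n + 1)"
    and C: "\<And>js. js \<in> index_lists n k \<Longrightarrow> \<bar>T (map (coord_vec M c x) (map f js))\<bar> \<le> C"
  shows "tensor_norm n (tangent_space M x) b k T \<le> real (card (index_lists n k)) * ((2 * real n) ^ k * C)"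
proof -
  define e where "e = (SOME e. sylvester_basis (tangent_space M x) b n 0 e)"
  have "\<exists>e. sylvester_basis (tangent_space M x) b n 0 e" using h by (simp add: inertia_forms_def)
  then have e: "sylvester_basis (tangent_space M x) b n 0 e" unfolding e_def by (rule someI_ex)
  note po = sylvester_basis_pseudo_orthonormal[OF e, simplified]
  have b: "b \<in> sym_forms (tangent_space M x)" using h by (simp add: inertia_forms_def)
  note V = tangent_subspace[OF charts_at_topspace[OF c]]
  note lin = coord_vec_linear[OF c]
  define g where "g i = coord_vec M c x (f i)" for i
  have gV: "g i \<in> tangent_space M x" for i unfolding g_def by (rule coord_vec_tangent[OF c])
  have coeff: "\<exists>a. e m = (\<Sum>i<n. a i *\<^sub>R g i) \<and> (\<forall>i<n. \<bar>a i\<bar> \<le> 2)" if m: "m < n" for m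
  proof -
    have eV: "e m \<in> tangent_space M x" using po m by (simp add: pseudo_orthonormal_def)
    obtain a where "e m c = (\<Sum>i<n. a i *\<^sub>R f i)"
      using span_image_lessThan[of "e m c" f n] f by auto
    then have "coord_vec M c x (e m c) = (\<Sum>i<n. a i *\<^sub>R g i)"
      by (simp add: linear_sum[OF lin] linear_scale[OF lin] g_def)
    then have a: "e m = (\<Sum>i<n. a i *\<^sub>R g i)" by (simp add: coord_vec_of_tangent[OF c eV])
    have "1 = b [e m, e m]" using po m by (simp add: pseudo_orthonormal_def inertia_sign_def)
    also have "\<dots> = b [(\<Sum>i<n. a i *\<^sub>R g i), e m]" using a by simp
    also have "\<dots> = (\<Sum>i<n. a i * b [g i, e m])"
      by (rule sym_forms_sum_left[OF b V eV gV])
    also have "\<dots> = (\<Sum>i<n. a i * (\<Sum>j<n. a j * b [g i, g j]))"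
      unfolding a by (simp only: sym_forms_sum_right[OF b V gV, where I = "{..<n}" and v = g and a = a] gV)
    finally have "(\<Sum>i<n. \<Sum>j<n. a i * a j * b [g i, g j]) = 1"
      by (simp add: sum_distrib_left mult.assoc)
    then have "\<bar>a i\<bar> \<le> 2" if "i < n" for i
      using that H by (intro almost_orthonormal_coefficients[of n "\<lambda>i j. b [g i, g j]"]) (auto simp: g_def)
    then show ?thesis using a by blast
  qed
  have "\<bar>T (map e js)\<bar> \<le> (2 * real n) ^ k * C" if js: "js \<in> index_lists n k" for js
  proof (rule multilinear_forms_bound[OF T V gV])
    show "\<bar>T (map g js)\<bar> \<le> C" if "length js = k" "set js \<subseteq> {..<n}" for js
      using C[of js] that by (simp add: g_def[abs_def] comp_def index_lists_def)
    show "length (map e js) = k" using js by (simp add: index_lists_def)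
    show "\<exists>a. v = (\<Sum>i<n. a i *\<^sub>R g i) \<and> (\<forall>i<n. \<bar>a i\<bar> \<le> 2)" if "v \<in> set (map e js)" for v
      using that js coeff by (auto simp: index_lists_def)
  qed
  then have "(\<Sum>js\<in>index_lists n k. \<bar>T (map e js)\<bar>) \<le> (\<Sum>js\<in>index_lists n k. (2 * real n) ^ k * C)"
    by (intro sum_mono)
  moreover have "tensor_norm n (tangent_space M x) b k T \<le> (\<Sum>js\<in>index_lists n k. \<bar>T (map e js)\<bar>)"
    unfolding tensor_norm_def Let_def e_def[symmetric] index_lists_def[symmetric] by (rule L2_set_le_sum_abs)
  ultimately show ?thesis by simp
qed

text \<open>The frame is chosen orthonormal for the metric at \<open>x0\<close> and extended with constant
  coordinates; both its Gram matrix and the components of the section vary continuously.\<close>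

lemma tensor_norm_locally_bounded:
  assumes h: "h \<in> riemannian_metrics n M" and s: "s \<in> smooth_sections M F"
    and F: "\<And>V. F V \<subseteq> multilinear_forms k V" and x0: "x0 \<in> topspace (mtop M)"
  shows "\<exists>C. \<forall>\<^sub>F x in nhdsin (mtop M) x0. tensor_norm n (tangent_space M x) (h x) k (s x) \<le> C"
proof -
  obtain c where c: "c \<in> charts_at M x0" using charts_cover[OF x0] by blast
  note c' = charts_atD[OF c]
  have hx: "h x \<in> inertia_forms n 0 (tangent_space M x)" if "x \<in> topspace (mtop M)" for x
    using h that unfolding riemannian_metrics_def smooth_sections_def by blast
  have hx0: "h x0 \<in> sym_forms (tangent_space M x0)" using hx[OF x0] by (simp add: inertia_forms_def)
  have "(\<lambda>us. h x0 (map (coord_vec M c x0) us)) \<in> inertia_forms n 0 UNIV"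
    using hx[OF x0] hx0 c by (simp add: triv_inertia)
  then obtain f where f: "sylvester_basis UNIV (\<lambda>us. h x0 (map (coord_vec M c x0) us)) n 0 f"
    by (auto simp: inertia_forms_def)
  note po = sylvester_basis_pseudo_orthonormal[OF f, simplified]
  \<comment> \<open>a bound for all components at \<open>x0\<close>, with room for the variation near \<open>x0\<close>\<close>
  define C where "C = (\<Sum>js\<in>index_lists n k. \<bar>s x0 (map (coord_vec M c x0) (map f js))\<bar>) + 1"
  have "\<forall>\<^sub>F x in nhdsin (mtop M) x0. \<bar>s x (map (coord_vec M c x) (map f js))\<bar> < C"
    if js: "js \<in> index_lists n k" for js
  proof (rule order_tendstoD(2))
    show "((\<lambda>x. \<bar>s x (map (coord_vec M c x) (map f js))\<bar>) \<longlongrightarrow>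
        \<bar>s x0 (map (coord_vec M c x0) (map f js))\<bar>) (nhdsin (mtop M) x0)"
      by (intro tendsto_rabs section_component_tendsto[OF s c])
    show "\<bar>s x0 (map (coord_vec M c x0) (map f js))\<bar> < C"
      unfolding C_def using js finite_index_lists
        member_le_sum[of js "index_lists n k" "\<lambda>js. \<bar>s x0 (map (coord_vec M c x0) (map f js))\<bar>"]
      by fastforce
  qed
  then have evC: "\<forall>\<^sub>F x in nhdsin (mtop M) x0.
      \<forall>js\<in>index_lists n k. \<bar>s x (map (coord_vec M c x) (map f js))\<bar> < C"
    by (intro eventually_ball_finite finite_index_lists) blast
  have "\<forall>\<^sub>F x in nhdsin (mtop M) x0.
      \<bar>h x (map (coord_vec M c x) [f i, f j]) - (if i = j then 1 else 0)\<bar> < 1 / (2 * real n + 1)"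
    if ij: "i < n" "j < n" for i j
  proof (rule order_tendstoD(2))
    have eq: "h x0 (map (coord_vec M c x0) [f i, f j]) = (if i = j then 1 else 0)"
      using po ij by (simp add: pseudo_orthonormal_def inertia_sign_def)
    have "((\<lambda>x. h x (map (coord_vec M c x) [f i, f j])) \<longlongrightarrow> (if i = j then 1 else 0)) (nhdsin (mtop M) x0)"
      unfolding eq[symmetric] by (rule section_component_tendsto[OF h[unfolded riemannian_metrics_def] c])
    from tendsto_rabs[OF tendsto_diff[OF this tendsto_const]]
    show "((\<lambda>x. \<bar>h x (map (coord_vec M c x) [f i, f j]) - (if i = j then 1 else 0)\<bar>) \<longlongrightarrow>
        \<bar>(if i = j then 1 else 0) - (if i = j then 1 else 0)\<bar>) (nhdsin (mtop M) x0)" .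
  qed simp
  then have evH: "\<forall>\<^sub>F x in nhdsin (mtop M) x0. \<forall>i\<in>{..<n}. \<forall>j\<in>{..<n}.
      \<bar>h x (map (coord_vec M c x) [f i, f j]) - (if i = j then 1 else 0)\<bar> < 1 / (2 * real n + 1)"
    by (intro eventually_ball_finite ballI finite_lessThan) (simp only: lessThan_iff)
  have evc: "\<forall>\<^sub>F x in nhdsin (mtop M) x0. c \<in> charts_at M x"
    unfolding eventually_nhdsin using c' chart_open[OF c'(1)]
    by (intro disjI2 exI[of _ "fst c"]) (auto simp: charts_at_def)
  have "\<forall>\<^sub>F x in nhdsin (mtop M) x0. tensor_norm n (tangent_space M x) (h x) k (s x) \<le>
      real (card (index_lists n k)) * ((2 * real n) ^ k * C)"
    using evC evH evc
  proof eventually_elim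
    case (elim x)
    have x: "x \<in> topspace (mtop M)" using elim(3) by (rule charts_at_topspace)
    have "s x \<in> F (tangent_space M x)" using s x unfolding smooth_sections_def by blast
    then have "s x \<in> multilinear_forms k (tangent_space M x)" using F by blast
    then show ?case
    proof (rule tensor_norm_bound[OF _ elim(3) hx[OF x]])
      show "span (f ` {..<n}) = UNIV" using f by (simp add: sylvester_basis_def)
      show "\<bar>h x [coord_vec M c x (f i), coord_vec M c x (f j)] - (if i = j then 1 else 0)\<bar> \<le>
          1 / (2 * real n + 1)" if "i < n" "j < n" for i j
        using elim(2)[rule_format, of i j] that by simp
    qed (use elim(1) in \<open>auto intro: less_imp_le\<close>)
  qed
  then show ?thesis by blast
qed

lemma tensor_norm_bdd_above:
  assumes h: "h \<in> riemannian_metrics n M" and s: "s \<in> smooth_sections M (sym2_tensors j)"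
    and K: "compactin (mtop M) K"
  shows "bdd_above ((\<lambda>x. tensor_norm n (tangent_space M x) (h x) (j + 2) (s x)) ` K)"
proof (rule locally_bounded_on_compact[OF K])
  fix x assume "x \<in> K"
  then have "x \<in> topspace (mtop M)" using compactin_subset_topspace[OF K] by blast
  then show "\<exists>C. \<forall>\<^sub>F y in nhdsin (mtop M) x. tensor_norm n (tangent_space M y) (h y) (j + 2) (s y) \<le> C"
    by (intro tensor_norm_locally_bounded[OF h s]) (auto simp: sym2_tensors_def)
qed

end


section \<open>Seminorms and contractibility\<close>

locale frechet_setting = smooth_mfd +
  fixes h and D :: "nat \<Rightarrow> ('a, 'b::real_inner) tensor_field \<Rightarrow> ('a, 'b) tensor_field"
  assumes metric: "h \<in> riemannian_metrics n M"
    and connections: "\<And>j. is_connection M (sym2_tensors j) (sym2_tensors (Suc j)) (D j)"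
begin

lemma iter_deriv_smooth:
  assumes "s \<in> sym2_sections M"
  shows "iter_deriv D j s \<in> smooth_sections M (sym2_tensors j)"
proof (induction j)
  case 0
  then show ?case using assms by (simp add: sym2_sections_def)
next
  case (Suc j)
  then show ?case using connections[of j] unfolding is_connection_def by simp
qed

text \<open>A connection is additive and homogeneous on smooth sections, so the induction also relies on
  the smoothness of the intermediate derivatives.\<close>

lemma iter_deriv_linear_combination:
  assumes s: "s \<in> sym2_sections M" "t \<in> sym2_sections M"
  shows "iter_deriv D j (a *\<^sub>R s + b *\<^sub>R t) = a *\<^sub>R iter_deriv D j s + b *\<^sub>R iter_deriv D j t"
proof (induction j)
  case (Suc j)
  have scale: "D j (a *\<^sub>R s) = a *\<^sub>R D j s" and smooth: "a *\<^sub>R s \<in> smooth_sections M (sym2_tensors j)"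
    if "s \<in> smooth_sections M (sym2_tensors j)" for s a
    using connections[of j] that smooth_sections_sym2_linear_combination[OF that that, of a 0]
    unfolding is_connection_def by auto
  have add: "D j (s + t) = D j s + D j t"
    if "s \<in> smooth_sections M (sym2_tensors j)" "t \<in> smooth_sections M (sym2_tensors j)" for s t
    using connections[of j] that unfolding is_connection_def by blast
  show ?case
    unfolding iter_deriv.simps Suc.IH
    by (simp only: add scale smooth iter_deriv_smooth[OF s(1)] iter_deriv_smooth[OF s(2)])
qed simp

text \<open>The summand of order \<open>j\<close> of the seminorms.\<close>

definition sup_norm :: "nat \<Rightarrow> 'a set \<Rightarrow> ('a, 'b) tensor_field \<Rightarrow> real"
  where "sup_norm j K s = Sup (insert 0
    ((\<lambda>x. tensor_norm n (tangent_space M x) (h x) (j + 2) (iter_deriv D j s x)) ` K))"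

lemma Ck_seminorm_eq: "Ck_seminorm n M h D k K s = (\<Sum>j\<le>k. sup_norm j K s)"
  by (simp add: Ck_seminorm_def sup_norm_def)

text \<open>This is where finiteness of the suprema enters: the supremum of an unbounded set of reals would
  be an unspecified number.\<close>

lemma sup_norm_upper:
  assumes "s \<in> sym2_sections M" "compactin (mtop M) K"
  shows "0 \<le> sup_norm j K s"
    and "x \<in> K \<Longrightarrow> tensor_norm n (tangent_space M x) (h x) (j + 2) (iter_deriv D j s x) \<le> sup_norm j K s"
  unfolding sup_norm_def
  using tensor_norm_bdd_above[OF metric iter_deriv_smooth[OF assms(1)] assms(2)]
  by (auto intro!: cSup_upper)

lemma sup_norm_linear_combination:
  assumes s: "s \<in> sym2_sections M" and t: "t \<in> sym2_sections M" and K: "compactin (mtop M) K"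
  shows "sup_norm j K (a *\<^sub>R s + b *\<^sub>R t) \<le> \<bar>a\<bar> * sup_norm j K s + \<bar>b\<bar> * sup_norm j K t"
  unfolding sup_norm_def[of j K "a *\<^sub>R s + b *\<^sub>R t"]
proof (rule cSup_least)
  fix y
  assume "y \<in> insert 0 ((\<lambda>x. tensor_norm n (tangent_space M x) (h x) (j + 2)
    (iter_deriv D j (a *\<^sub>R s + b *\<^sub>R t) x)) ` K)"
  then consider "y = 0" | x where "x \<in> K"
    "y = tensor_norm n (tangent_space M x) (h x) (j + 2) (iter_deriv D j (a *\<^sub>R s + b *\<^sub>R t) x)" by blast
  then show "y \<le> \<bar>a\<bar> * sup_norm j K s + \<bar>b\<bar> * sup_norm j K t"
  proof cases
    case 1
    then show ?thesis using sup_norm_upper(1)[OF s K] sup_norm_upper(1)[OF t K] by simp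
  next
    case 2
    let ?N = "\<lambda>s. tensor_norm n (tangent_space M x) (h x) (j + 2) (iter_deriv D j s x)"
    have "iter_deriv D j (a *\<^sub>R s + b *\<^sub>R t) x = a *\<^sub>R iter_deriv D j s x + b *\<^sub>R iter_deriv D j t x"
      unfolding iter_deriv_linear_combination[OF s t] by (simp add: scaleR_fun_def)
    then have "y \<le> \<bar>a\<bar> * ?N s + \<bar>b\<bar> * ?N t"
      unfolding 2(2) by (simp add: tensor_norm_linear_combination)
    also have "\<dots> \<le> \<bar>a\<bar> * sup_norm j K s + \<bar>b\<bar> * sup_norm j K t"
      using sup_norm_upper(2)[OF s K 2(1)] sup_norm_upper(2)[OF t K 2(1)]
      by (intro add_mono mult_left_mono) auto
    finally show ?thesis .
  qed
qed simp

lemma Ck_seminorm_nonneg: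
  assumes "s \<in> sym2_sections M" "compactin (mtop M) K"
  shows "0 \<le> Ck_seminorm n M h D k K s"
  unfolding Ck_seminorm_eq using sup_norm_upper(1)[OF assms] by (simp add: sum_nonneg)

lemma Ck_seminorm_linear_combination:
  assumes "s \<in> sym2_sections M" "t \<in> sym2_sections M" "compactin (mtop M) K"
  shows "Ck_seminorm n M h D k K (a *\<^sub>R s + b *\<^sub>R t) \<le>
    \<bar>a\<bar> * Ck_seminorm n M h D k K s + \<bar>b\<bar> * Ck_seminorm n M h D k K t"
proof -
  have "Ck_seminorm n M h D k K (a *\<^sub>R s + b *\<^sub>R t) \<le>
      (\<Sum>j\<le>k. \<bar>a\<bar> * sup_norm j K s + \<bar>b\<bar> * sup_norm j K t)"
    unfolding Ck_seminorm_eq by (intro sum_mono sup_norm_linear_combination assms)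
  then show ?thesis unfolding Ck_seminorm_eq by (simp add: sum.distrib sum_distrib_left)
qed

lemma sym2_sections_linear_combination:
  assumes "s \<in> sym2_sections M" "t \<in> sym2_sections M"
  shows "a *\<^sub>R s + b *\<^sub>R t \<in> sym2_sections M"
  using assms smooth_sections_sym2_linear_combination by (simp add: sym2_sections_def)

lemma sym2_sections_diff:
  assumes "s \<in> sym2_sections M" "t \<in> sym2_sections M"
  shows "s - t \<in> sym2_sections M"
  using sym2_sections_linear_combination[OF assms, of 1 "-1"] by simp

definition seminorm_ball :: "('a, 'b) tensor_field \<Rightarrow> nat \<Rightarrow> 'a set \<Rightarrow> real \<Rightarrow> ('a, 'b) tensor_field set"
  where "seminorm_ball s0 k K r = {s \<in> sym2_sections M. Ck_seminorm n M h D k K (s - s0) < r}"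

lemma frechet_topology_eq: "frechet_topology n M h D = topology_generated_by
    {seminorm_ball s0 k K r | s0 k K r. s0 \<in> sym2_sections M \<and> compactin (mtop M) K \<and> 0 < r}"
  by (simp add: frechet_topology_def seminorm_ball_def)

lemma openin_seminorm_ball:
  assumes "s0 \<in> sym2_sections M" "compactin (mtop M) K" "0 < r"
  shows "openin (frechet_topology n M h D) (seminorm_ball s0 k K r)"
  unfolding frechet_topology_eq using assms by (intro topology_generated_by_Basis) blast

lemma seminorm_ball_center:
  assumes "s0 \<in> sym2_sections M" "compactin (mtop M) K" "0 < r"
  shows "s0 \<in> seminorm_ball s0 k K r"
  using Ck_seminorm_linear_combination[OF assms(1,1,2), of k 0 0] assms
  by (simp add: seminorm_ball_def)

text \<open>Already the unit balls for the compact set \<open>{}\<close> contain everything.\<close>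

lemma topspace_frechet_topology: "topspace (frechet_topology n M h D) = sym2_sections M"
proof
  show "topspace (frechet_topology n M h D) \<subseteq> sym2_sections M"
    unfolding frechet_topology_eq by (auto simp: seminorm_ball_def)
  show "sym2_sections M \<subseteq> topspace (frechet_topology n M h D)"
  proof
    fix s assume s: "s \<in> sym2_sections M"
    have K: "compactin (mtop M) {}" by simp
    show "s \<in> topspace (frechet_topology n M h D)"
      using seminorm_ball_center[OF s K zero_less_one, of 0]
        openin_subset[OF openin_seminorm_ball[OF s K zero_less_one, of 0]] by blast
  qed
qed

text \<open>From
  \<open>H (t, g) - H (t0, g0) = (1 - t) *\<^sub>R (g - g0) + (t - t0) *\<^sub>R (g1 - g0)\<close>
  a seminorm \<open>N\<close> of the difference is at most \<open>N (g - g0) + \<bar>t - t0\<bar> * N (g1 - g0)\<close>. Hence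
  \<open>t\<close> must be close to \<open>t0\<close> in terms of the number \<open>N (g1 - g0)\<close>, and \<open>g\<close> close to \<open>g0\<close> in
  the same seminorm.\<close>

lemma straight_line_homotopy_continuous:
  assumes g1: "g1 \<in> sym2_sections M"
  shows "continuous_map (prod_topology (top_of_set {0..1}) (frechet_topology n M h D))
    (frechet_topology n M h D) (\<lambda>(t, g). (1 - t) *\<^sub>R g + t *\<^sub>R g1)"
proof -
  let ?X = "prod_topology (top_of_set {0..1}) (frechet_topology n M h D)"
  let ?H = "\<lambda>(t::real, g). (1 - t) *\<^sub>R g + t *\<^sub>R g1"
  have X: "topspace ?X = {0..1} \<times> sym2_sections M" by (simp add: topspace_frechet_topology)
  have H: "?H z \<in> sym2_sections M" if "z \<in> topspace ?X" for z
    using that g1 unfolding X by (auto intro: sym2_sections_linear_combination)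
  have pre: "openin ?X (?H -` seminorm_ball s0 k K r \<inter> topspace ?X)"
    if s0: "s0 \<in> sym2_sections M" and K: "compactin (mtop M) K" and r: "0 < r" for s0 k K r
  proof (subst openin_subopen, intro ballI)
    let ?N = "Ck_seminorm n M h D k K"
    fix z assume z: "z \<in> ?H -` seminorm_ball s0 k K r \<inter> topspace ?X"
    obtain t0 g0 where tg: "z = (t0, g0)" by (cases z)
    have t0: "0 \<le> t0" "t0 \<le> 1" and g0: "g0 \<in> sym2_sections M"
      using z X by (auto simp: tg)
    let ?m = "(1 - t0) *\<^sub>R g0 + t0 *\<^sub>R g1"
    define c0 where "c0 = ?N (?m - s0)"
    \<comment> \<open>half of the distance to the boundary of the ball, for each of the two error terms\<close>
    define \<epsilon> where "\<epsilon> = (r - c0) / 2"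
    have \<epsilon>: "0 < \<epsilon>" using z by (simp add: tg \<epsilon>_def c0_def seminorm_ball_def)
    have r_eq: "r - c0 = 2 * \<epsilon>" by (simp add: \<epsilon>_def)
    define L where "L = ?N (g1 - g0)"
    have L: "0 \<le> L" unfolding L_def by (intro Ck_seminorm_nonneg sym2_sections_diff g1 g0 K)
    define \<delta> where "\<delta> = \<epsilon> / (L + 1)"
    have \<delta>: "0 < \<delta>" "\<delta> * L \<le> \<epsilon>" using \<epsilon> L by (auto simp: \<delta>_def field_simps)
    let ?T = "({0..1} \<inter> ball t0 \<delta>) \<times> seminorm_ball g0 k K (\<epsilon>)"
    have "openin ?X ?T"
      using \<epsilon> by (simp add: openin_prod_Times_iff openin_open_Int openin_seminorm_ball[OF g0 K])
    moreover have "z \<in> ?T"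
      using t0 \<delta> \<epsilon> seminorm_ball_center[OF g0 K, of "\<epsilon>"] by (simp add: tg)
    moreover have "?T \<subseteq> ?H -` seminorm_ball s0 k K r \<inter> topspace ?X"
    proof
      fix y assume y: "y \<in> ?T"
      obtain t g where ytg: "y = (t, g)" by (cases y)
      have t: "0 \<le> t" "t \<le> 1" "\<bar>t - t0\<bar> < \<delta>" and g: "g \<in> sym2_sections M" "?N (g - g0) < \<epsilon>"
        using y by (auto simp: ytg seminorm_ball_def dist_real_def abs_minus_commute)
      have yX: "y \<in> topspace ?X" using t g unfolding X ytg by simp
      note secs = sym2_sections_diff[OF g(1) g0] sym2_sections_diff[OF g1 g0]
      have m: "?m - s0 \<in> sym2_sections M"
        by (intro sym2_sections_diff sym2_sections_linear_combination g0 g1 s0)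
      have d: "(1 - t) *\<^sub>R (g - g0) + (t - t0) *\<^sub>R (g1 - g0) \<in> sym2_sections M"
        by (intro sym2_sections_linear_combination secs)
      have split: "?H y - s0 = 1 *\<^sub>R (?m - s0) + 1 *\<^sub>R ((1 - t) *\<^sub>R (g - g0) + (t - t0) *\<^sub>R (g1 - g0))"
        by (simp add: ytg algebra_simps)
      have sum_bound: "A < r"
        if "A \<le> \<bar>1\<bar> * c0 + \<bar>1\<bar> * B" "B \<le> P + Q" "P \<le> 1 * G" "Q \<le> \<epsilon>" "G < \<epsilon>"
        for A B P Q G :: real
        using that r_eq unfolding abs_one mult_1 by linarith
      have "?N (?H y - s0) < r"
      proof (rule sum_bound)
        show "?N (?H y - s0) \<le> \<bar>1\<bar> * c0 + \<bar>1\<bar> * ?N ((1 - t) *\<^sub>R (g - g0) + (t - t0) *\<^sub>R (g1 - g0))"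
          unfolding split c0_def by (rule Ck_seminorm_linear_combination[OF m d K])
        show "?N ((1 - t) *\<^sub>R (g - g0) + (t - t0) *\<^sub>R (g1 - g0)) \<le> \<bar>1 - t\<bar> * ?N (g - g0) + \<bar>t - t0\<bar> * L"
          unfolding L_def by (rule Ck_seminorm_linear_combination[OF secs K])
        show "\<bar>1 - t\<bar> * ?N (g - g0) \<le> 1 * ?N (g - g0)"
          using t Ck_seminorm_nonneg[OF secs(1) K] by (intro mult_right_mono) auto
        show "\<bar>t - t0\<bar> * L \<le> \<epsilon>"
          using mult_right_mono[OF less_imp_le[OF t(3)] L] \<delta>(2) by (rule order_trans)
      qed (rule g(2))
      then show "y \<in> ?H -` seminorm_ball s0 k K r \<inter> topspace ?X"
        using H[OF yX] yX by (simp add: seminorm_ball_def)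
    qed
    ultimately show "\<exists>T. openin ?X T \<and> z \<in> T \<and> T \<subseteq> ?H -` seminorm_ball s0 k K r \<inter> topspace ?X"
      by blast
  qed
  have "?H ` topspace ?X \<subseteq> topspace (frechet_topology n M h D)"
    using H unfolding topspace_frechet_topology by blast
  then show ?thesis
    using pre unfolding frechet_topology_eq topology_generated_by_topspace
    by (intro continuous_on_generated_topo) auto
qed

text \<open>The metrics are contracted to the background metric along straight lines, which stay within
  the metrics by convexity.\<close>

theorem riemannian_metrics_contractible:
  "contractible_space (subtopology (frechet_topology n M h D) (riemannian_metrics n M))"
proof -
  let ?Y = "frechet_topology n M h D" and ?R = "riemannian_metrics n M"
  let ?H = "\<lambda>(t::real, g). (1 - t) *\<^sub>R g + t *\<^sub>R h"
  have "h \<in> sym2_sections M" using metric riemannian_metrics_subset by blast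
  then have "continuous_map (prod_topology (top_of_set {0..1}) ?Y) ?Y ?H"
    by (rule straight_line_homotopy_continuous)
  then have "continuous_map (prod_topology (top_of_set {0..1}) (subtopology ?Y ?R)) ?Y ?H"
    by (simp add: prod_topology_subtopology continuous_map_from_subtopology)
  moreover have "?H z \<in> ?R" if "z \<in> topspace (prod_topology (top_of_set {0..1}) (subtopology ?Y ?R))" for z
    using that metric riemannian_metrics_convex_combination by auto
  ultimately have "continuous_map (prod_topology (top_of_set {0..1}) (subtopology ?Y ?R)) (subtopology ?Y ?R) ?H"
    by (auto simp: continuous_map_in_subtopology)
  then have "homotopic_with (\<lambda>x. True) (subtopology ?Y ?R) (subtopology ?Y ?R) id (\<lambda>x. h)"
    unfolding homotopic_with_def by (intro exI[of _ ?H]) simp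
  then show ?thesis unfolding contractible_space_def by blast
qed

end

theorem proposition1p3:
  fixes M :: "('a, 'v::real_inner) manifold" and n p q :: nat
  assumes "smooth_manifold n M"
    and "second_countable (mtop M)"
    and "paracompact_space (mtop M)"
    and "p + q = n"
  shows "inertia_bundle M p q \<subseteq> S2T M \<and> open_subbundle M (inertia_bundle M p q) \<and>
    (\<forall>g0\<in>riemannian_metrics n M. \<forall>g1\<in>riemannian_metrics n M. \<forall>t\<in>{0..1::real}.
       (1 - t) *\<^sub>R g0 + t *\<^sub>R g1 \<in> riemannian_metrics n M) \<and>
    riemannian_metrics n M \<subseteq> sym2_sections M \<and> convex (riemannian_metrics n M) \<and>
    (\<forall>h nablaT nablaE D.
       h \<in> riemannian_metrics n M \<and> induced_connections M nablaT nablaE D \<longrightarrow>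
       riemannian_metrics n M \<noteq> {} \<and>
       contractible_space (subtopology (frechet_topology n M h D) (riemannian_metrics n M)))"
proof -
  interpret smooth_mfd n M by unfold_locales (rule assms(1))
  have "contractible_space (subtopology (frechet_topology n M h D) (riemannian_metrics n M))"
    if "h \<in> riemannian_metrics n M" "induced_connections M nablaT nablaE D" for h nablaT nablaE D
  proof -
    interpret frechet_setting n M h D
      using that by unfold_locales (auto simp: induced_connections_def)
    show ?thesis by (rule riemannian_metrics_contractible)
  qed
  then show ?thesis
    using inertia_bundle_subset[of p q] inertia_bundle_open_subbundle[OF assms(4)]
      riemannian_metrics_convex_combination riemannian_metrics_subset[of n M] riemannian_metrics_convex
    by auto
qed

end
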